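(* Let $P$ be a polyhedron and let $\alpha^+\colon\nabla(P)^+\to\mathbb{R}$ be the function $\alpha^+(f)=\chi(\mathrm{supp}(f))=\chi(|\overline{Z_{K_f,f}}|)$, where $K_f$ is any triangulation of $P$ linearizing $f$. The following hold. (1) $\alpha^+(0)=0$; (2) if $h\in\nabla(P)^+$ is a vl-Schauder hat, then $\alpha^+(h)=1$; (3) for all $f,g\in\nabla(P)^+$, $$\alpha^+(f+g)=\alpha^+(f\vee g)=\alpha^+(f)+\alpha^+(g)-\alpha^+(f\wedge g).$$
   Context: Simplices are (closed) convex hulls of finitely many affinely independent points (the vertices) of a Euclidean space. A simplicial complex is a finite set of simplices closed under taking faces and such that any two of its simplices intersect either in the empty set or in a common face. The polyhedron $|K|$ of a simplicial complex $K$ is the union of its simplices. A polyhedron is a subset $P$ of some $\mathbb{R}^n$ with $P=|K|$ for some simplicial complex $K$; any such $K$ is a triangulation of $P$. For a polyhedron $Q$, the Euler-Poincaré characteristic is $\chi(Q)=\sum_{m\geq 0}(-1)^m\alpha_m$, where $\alpha_m$ is the number of $m$-dimensional simplices of any triangulation of $Q$ (independent of the triangulation); $\chi(\emptyset)=0$. $\nabla(P)$ is the vector lattice (pointwise operations) of all continuous functions $f\colon P\to\mathbb{R}$ that are piecewise linear, i.e. for which there are finitely many affine linear functions $f_1,\dots,f_m\colon\mathbb{R}^n\to\mathbb{R}$ such that for every $s\in P$ there is $i$ with $f(s)=f_i(s)$. $\nabla(P)^+=\{f\in\nabla(P): f\geq 0\}$. A triangulation $K$ of $P$ linearizes $f$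 if $f$ is (affine) linear on each simplex of $K$; such a triangulation always exists. A vl-Schauder hat is an element $h\in\nabla(P)$ for which there are a triangulation $K_h$ of $P$ linearizing $h$ and a vertex $\bar x$ of $K_h$ such that $h(\bar x)=1$ and $h(x)=0$ for every other vertex $x$ of $K_h$. For a simplicial complex $K$, $K'$ denotes its first barycentric subdivision. For a subcomplex $L$ of $K$, the supplement $\overline{L}$ of $L$ in $K$ is the subcomplex of $K'$ consisting of those simplices of $K'$ having no vertex in $L'$. For $f\in\nabla(P)^+$ and a triangulation $K_f$ linearizing $f$, $Z_{K_f,f}$ is the subcomplex of $K_f$ of those simplices on which $f$ is identically zero, and $\overline{Z_{K_f,f}}$ is its supplement in $K_f$. The support is $\mathrm{supp}(f)=P\setminus f^{-1}(0)$ (no closure taken); it is homotopy equivalent to $|\overline{Z_{K_f,f}}|$, so $\chi(|\overline{Z_{K_f,f}}|)$ does not depend on the choice of $K_f$ and equals the (homological) Euler-Poincaré characteristic of $\mathrm{supp}(f)$, i.e. the alternating sum of the ranks of its homology groups. *)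

theory Defs
  imports "HOL-Analysis.Analysis" "HOL-Homology.Homology"
begin

section \<open>Simplicial complexes and polyhedra\<close>

text \<open>
  We use the library notion \<^const>\<open>simplicial_complex\<close>, in which the empty set is a face of
  every simplex (a simplex of dimension -1). Hence a nonempty complex contains \<open>{}\<close>; the empty
  simplex carries no points and no vertices, and it is never counted below.
  The library's constants \<^const>\<open>triangulation\<close> (no closure under faces) and
  \<^const>\<open>polyhedron\<close> (intersection of half-spaces) are different notions and are not used.
\<close>

definition triangulates :: "'a::euclidean_space set set \<Rightarrow> 'a set \<Rightarrow> bool" where
  "triangulates K P \<longleftrightarrow> simplicial_complex K \<and> \<Union>K = P"

definition pl_polyhedron :: "'a::euclidean_space set \<Rightarrow> bool" where
  "pl_polyhedron P \<longleftrightarrow> (\<exists>K. triangulates K P)"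

text \<open>The dimension of a simplex in \<open>'a\<close> is at most \<open>DIM('a)\<close>, so this is the full alternating sum.\<close>

definition complex_euler :: "'a::euclidean_space set set \<Rightarrow> int" where
  "complex_euler K = (\<Sum>m\<le>DIM('a). (-1) ^ m * int (card {S \<in> K. int m simplex S}))"

definition polyhedron_euler :: "'a::euclidean_space set \<Rightarrow> int" where
  "polyhedron_euler Q = complex_euler (SOME K. triangulates K Q)"


section \<open>Barycentric subdivision and supplements\<close>

definition simplex_vertices :: "'a::euclidean_space set \<Rightarrow> 'a set" where
  "simplex_vertices S = {v. v extreme_point_of S}"

definition barycenter :: "'a::euclidean_space set \<Rightarrow> 'a" where
  "barycenter S = (1 / real (card (simplex_vertices S))) *\<^sub>R \<Sum>(simplex_vertices S)"

text \<open>The simplices are spanned by the barycenters of flags of nonempty simplices; the empty flag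
  gives the empty simplex.\<close>

definition barycentric_subdivision :: "'a::euclidean_space set set \<Rightarrow> 'a set set" where
  "barycentric_subdivision K =
     {convex hull (barycenter ` C) | C.
        C \<subseteq> K - {{}} \<and> (\<forall>S\<in>C. \<forall>T\<in>C. S \<subseteq> T \<or> T \<subseteq> S)}"

definition supplement :: "'a::euclidean_space set set \<Rightarrow> 'a set set \<Rightarrow> 'a set set" where
  "supplement K L =
     {S \<in> barycentric_subdivision K.
        \<forall>v \<in> simplex_vertices S. {v} \<notin> barycentric_subdivision L}"


section \<open>Piecewise linear functions\<close>

definition affine_linear :: "('a::euclidean_space \<Rightarrow> real) \<Rightarrow> bool" where
  "affine_linear g \<longleftrightarrow> (\<exists>l c. linear l \<and> g = (\<lambda>x. l x + c))"

text \<open>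
  Functions on \<open>P\<close> are represented by total functions; values outside \<open>P\<close> are irrelevant to all
  definitions below.
\<close>

definition nabla :: "'a::euclidean_space set \<Rightarrow> ('a \<Rightarrow> real) set" where
  "nabla P = {f. continuous_on P f \<and>
     (\<exists>A. finite A \<and> (\<forall>g\<in>A. affine_linear g) \<and> (\<forall>s\<in>P. \<exists>g\<in>A. f s = g s))}"

definition nabla_pos :: "'a::euclidean_space set \<Rightarrow> ('a \<Rightarrow> real) set" where
  "nabla_pos P = {f \<in> nabla P. \<forall>x\<in>P. 0 \<le> f x}"

definition linearizes :: "'a::euclidean_space set set \<Rightarrow> ('a \<Rightarrow> real) \<Rightarrow> bool" where
  "linearizes K f \<longleftrightarrow> (\<forall>S\<in>K. \<exists>g. affine_linear g \<and> (\<forall>x\<in>S. f x = g x))"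

definition schauder_hat :: "'a::euclidean_space set \<Rightarrow> ('a \<Rightarrow> real) \<Rightarrow> bool" where
  "schauder_hat P h \<longleftrightarrow> h \<in> nabla P \<and>
     (\<exists>K v. triangulates K P \<and> linearizes K h \<and> {v} \<in> K \<and> h v = 1 \<and>
        (\<forall>w. {w} \<in> K \<and> w \<noteq> v \<longrightarrow> h w = 0))"

definition zero_subcomplex :: "'a::euclidean_space set set \<Rightarrow> ('a \<Rightarrow> real) \<Rightarrow> 'a set set" where
  "zero_subcomplex K f = {S \<in> K. \<forall>x\<in>S. f x = 0}"

definition supp :: "'a::euclidean_space set \<Rightarrow> ('a \<Rightarrow> real) \<Rightarrow> 'a set" where
  "supp P f = {x \<in> P. f x \<noteq> 0}"


section \<open>Homological Euler-Poincare characteristic\<close>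

text \<open>Linear independence over the integers in an abelian group (written multiplicatively).\<close>

definition int_independent :: "('g, 'm) monoid_scheme \<Rightarrow> 'g set \<Rightarrow> bool" where
  "int_independent G S \<longleftrightarrow> finite S \<and> S \<subseteq> carrier G \<and>
     (\<forall>c :: 'g \<Rightarrow> int.
        finprod G (\<lambda>x. x [^]\<^bsub>G\<^esub> c x) S = \<one>\<^bsub>G\<^esub> \<longrightarrow> (\<forall>x\<in>S. c x = 0))"

text \<open>Meaningful for abelian groups of finite rank only.\<close>

definition abelian_rank :: "('g, 'm) monoid_scheme \<Rightarrow> nat" where
  "abelian_rank G = Sup {card S | S. int_independent G S}"

text \<open>Meaningful for spaces whose homology groups have finite rank, almost all of them rank 0.\<close>

definition homology_euler :: "'a topology \<Rightarrow> int" where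
  "homology_euler X =
     (\<Sum>p | abelian_rank (homology_group (int p) X) \<noteq> 0.
        (-1) ^ p * int (abelian_rank (homology_group (int p) X)))"

definition alpha_plus :: "'a::euclidean_space set \<Rightarrow> ('a \<Rightarrow> real) \<Rightarrow> real" where
  "alpha_plus P f = real_of_int (homology_euler (top_of_set (supp P f)))"

end

theory Submission
  imports Defs
begin

text \<open>
  Every space in question is a finite union of disjoint cells such that the cells above a given cell
  \<open>c\<close> form an open set which is starlike around any point of \<open>c\<close>. Removing a minimal cell and
  applying excision and the long exact sequence of a pair shows by induction that its homology has
  finite rank and that its Euler characteristic is that of the order complex of the poset of cells.
  The cells of \<open>supp f\<close> can be taken to be the open simplices of \<open>K\<^sub>f\<close> outside the zero complex.
  The flags of these simplices are exactly the simplices of the supplement, and for a simplicial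
  complex the order complex of all its simplices has the same Euler characteristic as the complex
  itself, which gives the combinatorial formula. For a general \<open>f\<close> the cells of a hyperplane
  arrangement that determines the signs of the affine pieces show that \<open>supp f\<close> has homology of
  finite rank, so that Mayer-Vietoris additivity applies to \<open>supp f\<close> and \<open>supp g\<close>, whose union and
  intersection are the supports of \<open>max\<close> and \<open>min\<close>. The support of a hat is starlike.
\<close>

section \<open>Rank of abelian groups\<close>

text \<open>\<open>abelian_rank\<close> is a supremum that says nothing about finiteness, so
  homology is handled through the relations \<open>has_rank\<close> and \<open>has_euler\<close>,
  which assert finite rank together with its value; \<open>abelian_rank\<close> and
  \<open>homology_euler\<close> are read off from them. The cell induction succeeds because the
  topology and the order complex obey one recursion: the cells other than a minimal \<open>i\<close>
  and the star of \<open>i\<close> overlap in the cells strictly above \<open>i\<close>, and these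
  cells also form the link of the vertex \<open>i\<close> in the order complex. No map between
  \<open>supp P f\<close> and the supplement is therefore constructed; both characteristics are
  evaluated to the same number. Applied to all simplices of a complex, the cell theorem makes the
  combinatorial characteristic a homological invariant, which settles the choice of triangulation
  hidden in \<open>polyhedron_euler\<close>. For additivity no triangulation linearizing the
  functions is constructed: sign cells only use the affine pieces and the half-spaces cutting out
  the simplices of some triangulation of \<open>P\<close>.\<close>

lemma int_relation_of_many:
  fixes a :: "'i \<Rightarrow> 'j \<Rightarrow> int"
  assumes "finite J" "finite I" "card J < card I"
  shows "\<exists>c. (\<exists>i\<in>I. c i \<noteq> 0) \<and> (\<forall>j\<in>J. (\<Sum>i\<in>I. c i * a i j) = 0)"
  using assms
proof (induction J arbitrary: I a rule: finite_induct)
  case empty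
  then have "I \<noteq> {}" by auto
  then show ?case by (intro exI[of _ "\<lambda>_. 1"]) auto
next
  case (insert j J)
  show ?case
  proof (cases "\<forall>i\<in>I. a i j = 0")
    case True
    have "card J < card I" using insert.hyps insert.prems by simp
    then obtain c where "\<exists>i\<in>I. c i \<noteq> 0" "\<forall>l\<in>J. (\<Sum>i\<in>I. c i * a i l) = 0"
      using insert.IH[of I a] insert.prems(1) by blast
    then show ?thesis using True by (intro exI[of _ c]) simp
  next
    case False
    then obtain k where k: "k \<in> I" "a k j \<noteq> 0" by auto
    \<comment> \<open>Elimination without division: \<open>a'\<close> vanishes in column
      \<open>j\<close>, and multiplying by the pivot \<open>a k j\<close> instead of dividing by it
      keeps everything integral.\<close>
    define a' where "a' = (\<lambda>i l. a k j * a i l - a i j * a k l)"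
    have "card J < card (I - {k})"
      using insert.hyps insert.prems k by (simp add: card_Diff_singleton)
    then obtain c where c: "\<exists>i\<in>I - {k}. c i \<noteq> 0" "\<forall>l\<in>J. (\<Sum>i\<in>I - {k}. c i * a' i l) = 0"
      using insert.IH[of "I - {k}" a'] insert.prems(1) by blast
    \<comment> \<open>The coefficient at \<open>k\<close> is chosen so that equation
      \<open>j\<close> holds; scaling the others by the pivot turns every remaining equation for
      \<open>a\<close> into the one for \<open>a'\<close>.\<close>
    define c' where "c' = (\<lambda>i. if i = k then - (\<Sum>i\<in>I - {k}. c i * a i j) else c i * a k j)"
    have split: "(\<Sum>i\<in>I. c' i * a i l) = c' k * a k l + (\<Sum>i\<in>I - {k}. c i * a k j * a i l)" for l
    proof -
      have "(\<Sum>i\<in>I. c' i * a i l) = c' k * a k l + (\<Sum>i\<in>I - {k}. c' i * a i l)"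
        by (rule sum.remove[OF insert.prems(1) k(1)])
      also have "(\<Sum>i\<in>I - {k}. c' i * a i l) = (\<Sum>i\<in>I - {k}. c i * a k j * a i l)"
        by (rule sum.cong) (auto simp: c'_def)
      finally show ?thesis .
    qed
    have "(\<Sum>i\<in>I. c' i * a i l) = (\<Sum>i\<in>I - {k}. c i * a' i l)" for l
      unfolding split a'_def
      by (simp add: c'_def algebra_simps sum_subtractf sum_distrib_left)
    moreover have "(\<Sum>i\<in>I - {k}. c i * a' i j) = 0"
      by (simp add: a'_def)
    ultimately have "\<forall>l\<in>insert j J. (\<Sum>i\<in>I. c' i * a i l) = 0"
      using c(2) by auto
    moreover have "\<exists>i\<in>I. c' i \<noteq> 0" using c(1) k by (auto simp: c'_def)
    ultimately show ?thesis by blast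
  qed
qed

section \<open>Integer combinations and independent families\<close>

text \<open>Families indexed by an initial segment, unlike the sets in
  \<open>int_independent\<close>, can be concatenated, extended by one element and lifted along a
  homomorphism without caring about repetitions.\<close>

definition zcomb :: "('g, 'm) monoid_scheme \<Rightarrow> (nat \<Rightarrow> 'g) \<Rightarrow> (nat \<Rightarrow> int) \<Rightarrow> nat \<Rightarrow> 'g" where
  "zcomb G v c n = finprod G (\<lambda>i. v i [^]\<^bsub>G\<^esub> c i) {..<n}"

definition zindep :: "('g, 'm) monoid_scheme \<Rightarrow> (nat \<Rightarrow> 'g) \<Rightarrow> nat \<Rightarrow> bool" where
  "zindep G v n \<longleftrightarrow> v ` {..<n} \<subseteq> carrier G \<and>
     (\<forall>c. zcomb G v c n = \<one>\<^bsub>G\<^esub> \<longrightarrow> (\<forall>i<n. c i = 0))"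

text \<open>Measuring a subset \<open>H\<close> with the operations of \<open>G\<close> allows
  kernels and images to have a rank without becoming groups of their own.\<close>

definition has_rank :: "('g, 'm) monoid_scheme \<Rightarrow> 'g set \<Rightarrow> nat \<Rightarrow> bool" where
  "has_rank G H n \<longleftrightarrow> (\<exists>v. zindep G v n \<and> v ` {..<n} \<subseteq> H) \<and>
     (\<forall>v m. zindep G v m \<and> v ` {..<m} \<subseteq> H \<longrightarrow> m \<le> n)"

lemma has_rank_unique: "has_rank G H m \<Longrightarrow> has_rank G H n \<Longrightarrow> m = n"
  unfolding has_rank_def by (meson le_antisym)

lemma zindepD: "zindep G v n \<Longrightarrow> zcomb G v c n = \<one>\<^bsub>G\<^esub> \<Longrightarrow> i < n \<Longrightarrow> c i = 0"
  unfolding zindep_def by blast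

lemma zindep_carrier: "zindep G v n \<Longrightarrow> v ` {..<n} \<subseteq> carrier G"
  unfolding zindep_def by blast

context comm_group
begin

lemma zcomb_0 [simp]: "zcomb G v c 0 = \<one>"
  by (simp add: zcomb_def)

lemma zcomb_closed [simp]: "v ` {..<n} \<subseteq> carrier G \<Longrightarrow> zcomb G v c n \<in> carrier G"
  unfolding zcomb_def by (rule finprod_closed) auto

lemma zcomb_Suc:
  assumes "v ` {..<Suc n} \<subseteq> carrier G"
  shows "zcomb G v c (Suc n) = zcomb G v c n \<otimes> v n [^] c n"
proof -
  have *: "(\<lambda>i. v i [^] c i) \<in> {..<n} \<rightarrow> carrier G" "v n [^] c n \<in> carrier G"
    using assms by (auto simp: lessThan_Suc)
  have "zcomb G v c (Suc n) = v n [^] c n \<otimes> zcomb G v c n"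
    unfolding zcomb_def lessThan_Suc by (rule finprod_insert) (use * in auto)
  also have "\<dots> = zcomb G v c n \<otimes> v n [^] c n"
    by (intro m_comm) (use assms in \<open>auto simp: image_subset_iff\<close>)
  finally show ?thesis .
qed

lemma zcomb_cong:
  assumes "v ` {..<n} \<subseteq> carrier G" "\<And>i. i < n \<Longrightarrow> w i = v i" "\<And>i. i < n \<Longrightarrow> d i = c i"
  shows "zcomb G w d n = zcomb G v c n"
  unfolding zcomb_def by (rule finprod_cong') (use assms in auto)

lemma zcomb_add:
  assumes "v ` {..<n} \<subseteq> carrier G"
  shows "zcomb G v (\<lambda>i. c i + d i) n = zcomb G v c n \<otimes> zcomb G v d n"
proof -
  have "zcomb G v (\<lambda>i. c i + d i) n = finprod G (\<lambda>i. v i [^] c i \<otimes> v i [^] d i) {..<n}"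
    unfolding zcomb_def by (rule finprod_cong') (use assms in \<open>auto simp: int_pow_mult\<close>)
  then show ?thesis
    unfolding zcomb_def using assms by (subst finprod_multf[symmetric]) auto
qed

lemma zcomb_zero: "(\<And>i. i < n \<Longrightarrow> c i = 0) \<Longrightarrow> zcomb G v c n = \<one>"
  unfolding zcomb_def by (rule finprod_one_eqI) auto

lemma zcomb_scale:
  assumes "v ` {..<n} \<subseteq> carrier G"
  shows "zcomb G v (\<lambda>i. c i * k) n = zcomb G v c n [^] k"
  using assms
proof (induction n)
  case (Suc n)
  then have "v ` {..<n} \<subseteq> carrier G" "v n \<in> carrier G" by (auto simp: lessThan_Suc)
  then show ?case
    using Suc by (simp add: zcomb_Suc int_pow_distrib int_pow_pow)
qed simp

lemma zcomb_zcomb: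
  assumes "w ` {..<n} \<subseteq> carrier G"
  shows "zcomb G (\<lambda>i. zcomb G w (a i) n) c m = zcomb G w (\<lambda>j. \<Sum>i<m. c i * a i j) n"
proof (induction m)
  case 0
  then show ?case by (simp add: zcomb_zero)
next
  case (Suc m)
  have "zcomb G (\<lambda>i. zcomb G w (a i) n) c (Suc m)
      = zcomb G w (\<lambda>j. \<Sum>i<m. c i * a i j) n \<otimes> zcomb G w (a m) n [^] c m"
    using Suc assms by (subst zcomb_Suc) auto
  also have "zcomb G w (a m) n [^] c m = zcomb G w (\<lambda>j. c m * a m j) n"
    using zcomb_scale[OF assms, of "a m" "c m"] by (simp add: mult.commute)
  finally show ?case
    by (simp add: zcomb_add[OF assms, symmetric])
qed

lemma zcomb_append:
  assumes "v ` {..<m + n} \<subseteq> carrier G"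
  shows "zcomb G v c (m + n) = zcomb G v c m \<otimes> zcomb G (\<lambda>i. v (m + i)) (\<lambda>i. c (m + i)) n"
  using assms
proof (induction n)
  case 0
  then show ?case by simp
next
  case (Suc n)
  have v: "\<And>i. i < Suc (m + n) \<Longrightarrow> v i \<in> carrier G" using Suc.prems by auto
  have 1: "(\<lambda>i. v (m + i)) ` {..<Suc n} \<subseteq> carrier G" using v by auto
  have 2: "zcomb G v c (m + Suc n) = zcomb G v c (m + n) \<otimes> v (m + n) [^] c (m + n)"
    using zcomb_Suc[of v "m + n" c] v by auto
  have 3: "zcomb G v c m \<in> carrier G"
    "zcomb G (\<lambda>i. v (m + i)) (\<lambda>i. c (m + i)) n \<in> carrier G" "v (m + n) [^] c (m + n) \<in> carrier G"
    using v by (auto intro!: zcomb_closed)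
  have "v ` {..<m + n} \<subseteq> carrier G" using v by auto
  from Suc.IH[OF this] show ?case
    using 2 3 by (simp add: zcomb_Suc[OF 1] m_assoc)
qed

text \<open>If \<open>m > n\<close>, the exponent vectors \<open>a i\<close> satisfy a nontrivial
  integer relation \<open>c\<close>, and \<open>k i * c i\<close> is then a nontrivial relation
  among the \<open>v i\<close>. Only a nonzero power of each \<open>v i\<close> is asked to be in
  the span, because over the integers a maximal independent family generates no more than
  that.\<close>

lemma zindep_le_span:
  assumes v: "zindep G v m" and w: "w ` {..<n} \<subseteq> carrier G"
    and span: "\<And>i. i < m \<Longrightarrow> \<exists>k::int. \<exists>a. k \<noteq> 0 \<and> v i [^] k = zcomb G w a n"
  shows "m \<le> n"
proof (rule ccontr)
  assume "\<not> m \<le> n"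
  obtain k :: "nat \<Rightarrow> int" and a where ka: "\<And>i. i < m \<Longrightarrow> k i \<noteq> 0 \<and> v i [^] k i = zcomb G w (a i) n"
    using span by metis
  obtain c where c: "\<exists>i<m. c i \<noteq> 0" "\<And>j. j < n \<Longrightarrow> (\<Sum>i<m. c i * a i j) = 0"
    using int_relation_of_many[of "{..<n}" "{..<m}" a] \<open>\<not> m \<le> n\<close> by auto
  have vc: "\<And>i. i < m \<Longrightarrow> v i \<in> carrier G" using zindep_carrier[OF v] by auto
  have "zcomb G v (\<lambda>i. k i * c i) m = zcomb G (\<lambda>i. zcomb G w (a i) n) c m"
    unfolding zcomb_def[of G v] zcomb_def[of G "\<lambda>i. zcomb G w (a i) n"]
    by (rule finprod_cong') (use w ka in \<open>auto simp: int_pow_pow[symmetric] vc\<close>)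
  also have "\<dots> = \<one>"
    by (subst zcomb_zcomb[OF w]) (use c in \<open>auto intro: zcomb_zero\<close>)
  finally have "\<forall>i<m. k i * c i = 0" using v unfolding zindep_def by blast
  then show False using ka c by auto
qed

text \<open>Appending \<open>x\<close> to an independent family of maximal length creates a
  relation. The exponent of \<open>x\<close> in it is nonzero, since otherwise the relation would
  concern \<open>v\<close> alone.\<close>

lemma has_rank_spans:
  assumes H: "H \<subseteq> carrier G" and r: "has_rank G H n" and v: "zindep G v n" "v ` {..<n} \<subseteq> H"
    and x: "x \<in> H"
  shows "\<exists>k::int. \<exists>a. k \<noteq> 0 \<and> x [^] k = zcomb G v a n"
proof -
  define u where "u = v(n := x)"
  have uc: "u ` {..<Suc n} \<subseteq> H" using v x by (auto simp: u_def less_Suc_eq)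
  then have "\<not> zindep G u (Suc n)" using r unfolding has_rank_def by (metis Suc_n_not_le_n)
  then obtain c i where c: "zcomb G u c (Suc n) = \<one>" "i < Suc n" "c i \<noteq> 0"
    using uc H unfolding zindep_def by blast
  have vH: "v ` {..<n} \<subseteq> carrier G" and xG: "x \<in> carrier G" using v H x by auto
  have "zcomb G u c n = zcomb G v c n"
    by (rule zcomb_cong[OF vH]) (auto simp: u_def)
  then have eq: "zcomb G v c n \<otimes> x [^] c n = \<one>"
    using c(1) zcomb_Suc[of u n c] subset_trans[OF uc H] by (simp add: u_def)
  have "c n \<noteq> 0"
  proof
    assume 0: "c n = 0"
    then have "zcomb G v c n = \<one>" using eq vH by simp
    then have "\<forall>i<n. c i = 0" using v(1) unfolding zindep_def by blast
    then show False using c 0 by (auto simp: less_Suc_eq)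
  qed
  moreover have "x [^] c n = zcomb G v (\<lambda>i. c i * (-1)) n"
  proof -
    have "x [^] c n = inv (zcomb G v c n)"
      using eq vH xG by (metis inv_equality int_pow_closed inv_inv inv_closed zcomb_closed)
    then show ?thesis
      by (metis zcomb_scale[OF vH] int_pow_neg int_pow_1 zcomb_closed[OF vH])
  qed
  ultimately show ?thesis by blast
qed

text \<open>A repetition \<open>v i = v j\<close> would give the relation with coefficient 1 at
  \<open>i\<close> and -1 at \<open>j\<close>. This allows passing from families to sets.\<close>

lemma zindep_inj:
  assumes v: "zindep G v n"
  shows "inj_on v {..<n}"
proof (rule inj_onI)
  fix i j assume ij: "i \<in> {..<n}" "j \<in> {..<n}" "v i = v j"
  have vc: "\<And>i. i < n \<Longrightarrow> v i \<in> carrier G" using zindep_carrier[OF v] by auto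
  show "i = j"
  proof (rule ccontr)
    assume "i \<noteq> j"
    have delta: "zcomb G v (\<lambda>k. if k = i then e else 0) n = v i [^] e" if "i < n" for e :: int and i
    proof -
      have "zcomb G v (\<lambda>k. if k = i then e else 0) n
          = finprod G (\<lambda>k. if i = k then v k [^] e else \<one>) {..<n}"
        unfolding zcomb_def by (rule finprod_cong') (auto simp: vc)
      also have "\<dots> = v i [^] e" by (rule finprod_singleton) (use that vc in auto)
      finally show ?thesis .
    qed
    let ?c = "\<lambda>k. (if k = i then 1 else 0) + (if k = j then -1 else (0::int))"
    have "zcomb G v ?c n = v i [^] (1::int) \<otimes> v j [^] (-1::int)"
      using zcomb_add[of v n "\<lambda>k. if k = i then 1 else 0" "\<lambda>k. if k = j then -1 else 0"]
        delta ij vc by (auto simp: image_subset_iff)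
    also have "\<dots> = \<one>" using ij vc by (simp add: int_pow_neg)
    finally have "?c i = 0" using zindepD[OF v, of ?c i] ij by blast
    then show False using \<open>i \<noteq> j\<close> by simp
  qed
qed

text \<open>The bridge back to \<open>int_independent\<close>: the range of an independent family is
  an independent set of the same size, and enumerating an independent set gives an independent
  family.\<close>

lemma abelian_rank_eq:
  assumes "has_rank G (carrier G) n"
  shows "abelian_rank G = n"
proof -
  let ?A = "{card S | S. int_independent G S}"
  obtain v where v: "zindep G v n" using assms unfolding has_rank_def by blast
  have inj: "inj_on v {..<n}" by (rule zindep_inj[OF v])
  have vc: "v ` {..<n} \<subseteq> carrier G" by (rule zindep_carrier[OF v])
  have "int_independent G (v ` {..<n})"
    unfolding int_independent_def
  proof (intro conjI allI impI)
    fix c :: "'a \<Rightarrow> int"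
    assume "finprod G (\<lambda>x. x [^] c x) (v ` {..<n}) = \<one>"
    also have "finprod G (\<lambda>x. x [^] c x) (v ` {..<n}) = zcomb G v (c \<circ> v) n"
      unfolding zcomb_def o_def by (rule finprod_reindex) (use inj vc in auto)
    finally show "\<forall>x\<in>v ` {..<n}. c x = 0"
      using zindepD[OF v] by fastforce
  qed (use vc in auto)
  then have "n \<in> ?A" using card_image[OF inj] by (intro CollectI exI[of _ "v ` {..<n}"]) simp
  moreover have "x \<le> n" if "x \<in> ?A" for x
  proof -
    obtain S where S: "int_independent G S" "x = card S" using \<open>x \<in> ?A\<close> by auto
    then have fin: "finite S" and SG: "S \<subseteq> carrier G" by (auto simp: int_independent_def)
    obtain w where w: "bij_betw w {..<card S} S"
      using ex_bij_betw_nat_finite[OF fin] by (auto simp: atLeast0LessThan)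
    then have wS: "w ` {..<card S} = S" and winj: "inj_on w {..<card S}" by (auto simp: bij_betw_def)
    have "zindep G w (card S)"
      unfolding zindep_def
    proof (intro conjI allI impI)
      fix c i assume c: "zcomb G w c (card S) = \<one>" and i: "i < card S"
      define d where "d = c \<circ> the_inv_into {..<card S} w"
      have dw: "d (w i) = c i" if "i < card S" for i
        using winj that by (simp add: d_def the_inv_into_f_f)
      have "finprod G (\<lambda>x. x [^] d x) (w ` {..<card S}) = finprod G (\<lambda>i. w i [^] d (w i)) {..<card S}"
        by (rule finprod_reindex) (use winj wS SG in auto)
      also have "\<dots> = zcomb G w c (card S)"
        unfolding zcomb_def by (rule finprod_cong') (use wS SG dw in auto)
      finally have "\<forall>x\<in>S. d x = 0" using S c unfolding int_independent_def wS by auto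
      moreover have "w i \<in> S" using i wS by auto
      ultimately show "c i = 0" using dw[OF i] by simp
    qed (use wS SG in auto)
    then show "x \<le> n" using assms wS SG S(2) unfolding has_rank_def by blast
  qed
  ultimately show ?thesis
    unfolding abelian_rank_def by (rule cSup_eq_maximum)
qed

lemma has_rank_trivial: "has_rank G {\<one>} 0"
  unfolding has_rank_def
proof (intro conjI exI allI impI)
  fix v :: "nat \<Rightarrow> 'a" and m assume v: "zindep G v m \<and> v ` {..<m} \<subseteq> {\<one>}"
  show "m \<le> 0"
  proof (rule ccontr)
    assume "\<not> m \<le> 0"
    moreover have "zcomb G v (\<lambda>_. 1) m = \<one>"
      unfolding zcomb_def by (rule finprod_one_eqI) (use v in \<open>auto simp: image_subset_iff\<close>)
    ultimately show False using zindepD[of G v m "\<lambda>_. 1" 0] v by auto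
  qed
qed (auto simp: zindep_def)

end

section \<open>Ranks of kernels and images\<close>

lemma zcomb_hom:
  assumes "comm_group G" "comm_group K" "h \<in> hom G K" "v ` {..<n} \<subseteq> carrier G"
  shows "h (zcomb G v c n) = zcomb K (\<lambda>i. h (v i)) c n"
  using assms(4)
proof (induction n)
  case 0
  interpret G: comm_group G by fact
  interpret K: comm_group K by fact
  show ?case using hom_one[OF assms(3)] by simp
next
  case (Suc n)
  interpret G: comm_group G by fact
  interpret K: comm_group K by fact
  have v: "v ` {..<n} \<subseteq> carrier G" "v n \<in> carrier G" using Suc.prems by (auto simp: lessThan_Suc)
  have hv: "(\<lambda>i. h (v i)) ` {..<Suc n} \<subseteq> carrier K"
    using Suc.prems hom_carrier[OF assms(3)] by blast
  show ?case
    using v hv Suc.IH[OF v(1)]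
    by (simp add: G.zcomb_Suc[OF Suc.prems] K.zcomb_Suc[OF hv] hom_mult[OF assms(3)]
        hom_int_pow[OF assms(3)] G.is_group K.is_group)
qed

lemma has_rank_exists:
  assumes bound: "\<And>v m. zindep G v m \<Longrightarrow> v ` {..<m} \<subseteq> H \<Longrightarrow> m \<le> N" and "comm_group G"
  shows "\<exists>n. has_rank G H n"
proof -
  interpret comm_group G by fact
  let ?P = "\<lambda>m. \<exists>v. zindep G v m \<and> v ` {..<m} \<subseteq> H"
  have "?P 0" by (auto simp: zindep_def)
  then have "?P (Greatest ?P)" by (rule GreatestI_nat) (use bound in blast)
  moreover have "m \<le> Greatest ?P" if "?P m" for m
    using that by (rule Greatest_le_nat) (use bound in blast)
  ultimately show ?thesis unfolding has_rank_def by blast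
qed

text \<open>Rank-nullity: a maximal independent family \<open>w\<close> of the kernel, followed by
  preimages \<open>x\<close> of a maximal independent family \<open>u\<close> of the image, is
  independent and spans up to multiples.\<close>

lemma has_rank_join:
  assumes "comm_group G" "comm_group K" and h: "h \<in> hom G K"
    and k: "has_rank G (kernel G K h) k" and r: "has_rank K (h ` carrier G) r"
  shows "has_rank G (carrier G) (k + r)"
proof -
  interpret G: comm_group G by fact
  interpret K: comm_group K by fact
  interpret group_hom G K h using h by unfold_locales
  obtain w where w: "zindep G w k" "w ` {..<k} \<subseteq> kernel G K h" using k unfolding has_rank_def by blast
  obtain u where u: "zindep K u r" "u ` {..<r} \<subseteq> h ` carrier G" using r unfolding has_rank_def by blast
  then have "\<forall>i<r. \<exists>x. x \<in> carrier G \<and> h x = u i"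
    by (metis image_subset_iff imageE lessThan_iff)
  then obtain x where x: "\<And>i. i < r \<Longrightarrow> x i \<in> carrier G \<and> h (x i) = u i" by metis
  define b where "b = (\<lambda>i. if i < k then w i else x (i - k))"
  have wc: "w ` {..<k} \<subseteq> carrier G" using w by (auto simp: kernel_def)
  have xc: "x ` {..<r} \<subseteq> carrier G" using x by auto
  have uc: "u ` {..<r} \<subseteq> carrier K" using zindep_carrier[OF u(1)] .
  have bc: "b ` {..<k + r} \<subseteq> carrier G" using wc xc by (auto simp: b_def)
  have b_split: "zcomb G b c (k + r) = zcomb G w c k \<otimes>\<^bsub>G\<^esub> zcomb G x (\<lambda>i. c (k + i)) r" for c
    unfolding G.zcomb_append[OF bc]
    by (intro arg_cong2[of _ _ _ _ "mult G"] G.zcomb_cong wc xc) (auto simp: b_def)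
  have h_w: "h (zcomb G w c k) = \<one>\<^bsub>K\<^esub>" for c
    unfolding zcomb_hom[OF assms(1,2) h wc] unfolding zcomb_def
    by (rule K.finprod_one_eqI) (use w in \<open>auto simp: kernel_def image_subset_iff\<close>)
  have h_x: "h (zcomb G x c r) = zcomb K u c r" for c
    unfolding zcomb_hom[OF assms(1,2) h xc] by (rule K.zcomb_cong) (use uc x in auto)
  have "zindep G b (k + r)"
    unfolding zindep_def
  proof (intro conjI allI impI)
    fix c i assume c: "zcomb G b c (k + r) = \<one>\<^bsub>G\<^esub>" and i: "i < k + r"
    have "h (zcomb G w c k \<otimes>\<^bsub>G\<^esub> zcomb G x (\<lambda>i. c (k + i)) r) = \<one>\<^bsub>K\<^esub>"
      using c by (simp add: b_split)
    then have "zcomb K u (\<lambda>i. c (k + i)) r = \<one>\<^bsub>K\<^esub>"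
      using wc xc uc by (simp add: h_w h_x)
    then have 1: "\<And>i. i < r \<Longrightarrow> c (k + i) = 0" using zindepD[OF u(1), of "\<lambda>i. c (k + i)"] by blast
    then have "zcomb G x (\<lambda>i. c (k + i)) r = \<one>\<^bsub>G\<^esub>" by (auto intro: G.zcomb_zero)
    then have "zcomb G w c k = \<one>\<^bsub>G\<^esub>" using c b_split wc by simp
    then have 2: "\<And>i. i < k \<Longrightarrow> c i = 0" using zindepD[OF w(1)] by blast
    show "c i = 0" using 1[of "i - k"] 2[of i] i by (cases "i < k") auto
  qed (rule bc)
  moreover have "m \<le> k + r" if m: "zindep G v m" for v m
  proof (rule G.zindep_le_span[OF m bc])
    fix i assume "i < m"
    define y where "y = v i"
    have y: "y \<in> carrier G" using zindep_carrier[OF m] \<open>i < m\<close> by (auto simp: y_def)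
    have im: "h ` carrier G \<subseteq> carrier K" "h y \<in> h ` carrier G" using y hom_closed by auto
    \<comment> \<open>A multiple of \<open>h y\<close> is a combination of \<open>u\<close>.
      Dividing by the corresponding combination \<open>z\<close> of preimages lands in the kernel,
      where a further power \<open>q\<close> is a combination of \<open>w\<close>; so the power
      \<open>p * q\<close> of \<open>y\<close> is a combination of \<open>b\<close>.\<close>
    obtain p :: int and a where p: "p \<noteq> 0" "h y [^]\<^bsub>K\<^esub> p = zcomb K u a r"
      using K.has_rank_spans[OF im(1) r u im(2)] by metis
    define z where "z = zcomb G x a r"
    have z: "z \<in> carrier G" using xc by (simp add: z_def)
    have "h (y [^]\<^bsub>G\<^esub> p \<otimes>\<^bsub>G\<^esub> inv\<^bsub>G\<^esub> z) = \<one>\<^bsub>K\<^esub>"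
      using y z p(2) h_x[of a] uc by (simp add: hom_int_pow z_def[symmetric])
    then have "y [^]\<^bsub>G\<^esub> p \<otimes>\<^bsub>G\<^esub> inv\<^bsub>G\<^esub> z \<in> kernel G K h" using y z by (simp add: kernel_def)
    moreover have "kernel G K h \<subseteq> carrier G" by (auto simp: kernel_def)
    ultimately obtain q :: int and d
      where q: "q \<noteq> 0" "(y [^]\<^bsub>G\<^esub> p \<otimes>\<^bsub>G\<^esub> inv\<^bsub>G\<^esub> z) [^]\<^bsub>G\<^esub> q = zcomb G w d k"
      using G.has_rank_spans[OF _ k w] by metis
    have zz: "z [^]\<^bsub>G\<^esub> q = zcomb G x (\<lambda>i. a i * q) r" using G.zcomb_scale[OF xc] by (simp add: z_def)
    have "y [^]\<^bsub>G\<^esub> (p * q) = (y [^]\<^bsub>G\<^esub> p \<otimes>\<^bsub>G\<^esub> inv\<^bsub>G\<^esub> z) [^]\<^bsub>G\<^esub> q \<otimes>\<^bsub>G\<^esub> z [^]\<^bsub>G\<^esub> q"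
      using y z by (simp add: G.int_pow_distrib G.int_pow_inv G.int_pow_pow G.m_assoc)
    also have "\<dots> = zcomb G b (\<lambda>i. if i < k then d i else a (i - k) * q) (k + r)"
      unfolding b_split q(2) zz
      by (intro arg_cong2[of _ _ _ _ "mult G"] G.zcomb_cong wc xc) auto
    finally have eq: "y [^]\<^bsub>G\<^esub> (p * q) = zcomb G b (\<lambda>i. if i < k then d i else a (i - k) * q) (k + r)" .
    have "p * q \<noteq> 0" using p(1) q(1) by simp
    then have "p * q \<noteq> 0 \<and> v i [^]\<^bsub>G\<^esub> (p * q)
        = zcomb G b (\<lambda>i. if i < k then d i else a (i - k) * q) (k + r)"
      using eq unfolding y_def by (rule conjI)
    then show "\<exists>k'::int. \<exists>a. k' \<noteq> 0 \<and> v i [^]\<^bsub>G\<^esub> k' = zcomb G b a (k + r)"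
      by blast
  qed
  ultimately show ?thesis using bc unfolding has_rank_def by blast
qed

text \<open>The direction in which finiteness is inherited: families in the kernel are families in
  \<open>G\<close>, and preimages of an independent family in the image are independent, so both
  ranks exist and are at most \<open>n\<close>. The equation is \<open>has_rank_join\<close> plus
  uniqueness.\<close>

lemma has_rank_split:
  assumes "comm_group G" "comm_group K" and h: "h \<in> hom G K" and n: "has_rank G (carrier G) n"
  obtains k r where "has_rank G (kernel G K h) k" "has_rank K (h ` carrier G) r" "n = k + r"
proof -
  interpret G: comm_group G by fact
  interpret K: comm_group K by fact
  interpret group_hom G K h using h by unfold_locales
  have bound: "m \<le> n" if "zindep G v m" for v m
    using n that zindep_carrier[OF that] unfolding has_rank_def by metis
  obtain k where k: "has_rank G (kernel G K h) k"
    using has_rank_exists[of G "kernel G K h" n] bound assms(1) by blast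
  have "m \<le> n" if u: "zindep K u m" "u ` {..<m} \<subseteq> h ` carrier G" for u m
  proof -
    have "\<forall>i<m. \<exists>x. x \<in> carrier G \<and> h x = u i"
      using u(2) by (metis image_subset_iff imageE lessThan_iff)
    then obtain x where x: "\<And>i. i < m \<Longrightarrow> x i \<in> carrier G \<and> h (x i) = u i" by metis
    then have xc: "x ` {..<m} \<subseteq> carrier G" by auto
    have "zindep G x m"
      unfolding zindep_def
    proof (intro conjI allI impI)
      fix c i assume c: "zcomb G x c m = \<one>\<^bsub>G\<^esub>" and i: "i < m"
      have "zcomb K u c m = zcomb K (\<lambda>i. h (x i)) c m"
      proof (rule K.zcomb_cong)
        show "(\<lambda>i. h (x i)) ` {..<m} \<subseteq> carrier K" using x hom_closed by blast
      qed (use x in auto)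
      also have "\<dots> = h (zcomb G x c m)" using zcomb_hom[OF assms(1,2) h xc] by simp
      finally show "c i = 0" using c i zindepD[OF u(1)] by simp
    qed (rule xc)
    then show ?thesis by (rule bound)
  qed
  then obtain r where r: "has_rank K (h ` carrier G) r"
    using has_rank_exists[of K "h ` carrier G" n] assms(2) by blast
  show thesis
    using that[OF k r] has_rank_unique[OF n has_rank_join[OF assms(1-3) k r]] by blast
qed

lemma has_rank_iso:
  assumes "comm_group G" "comm_group K" "h \<in> iso G K" "has_rank G (carrier G) n"
  shows "has_rank K (carrier K) n"
proof -
  interpret G: comm_group G by fact
  interpret K: comm_group K by fact
  have h: "h \<in> hom G K" "bij_betw h (carrier G) (carrier K)" using assms(3) by (auto simp: iso_def)
  interpret group_hom G K h using h(1) by unfold_locales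
  obtain k r where kr: "has_rank G (kernel G K h) k" "has_rank K (h ` carrier G) r" "n = k + r"
    using has_rank_split[OF assms(1,2) h(1) assms(4)] .
  have "kernel G K h = {\<one>\<^bsub>G\<^esub>}"
    using h(2) inj_iff_trivial_ker unfolding bij_betw_def by metis
  then have "k = 0" using kr(1) G.has_rank_trivial has_rank_unique by metis
  then show ?thesis using kr h(2) by (simp add: bij_betw_def)
qed

lemma has_rank_isomorphic:
  assumes "comm_group G" "comm_group K" "G \<cong> K" "has_rank G (carrier G) n"
  shows "has_rank K (carrier K) n"
proof -
  obtain h where "h \<in> iso G K" using assms(3) by (auto simp: is_iso_def)
  from has_rank_iso[OF assms(1,2) this assms(4)] show ?thesis .
qed

lemma has_rank_trivial_group:
  assumes "trivial_group G" "comm_group G"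
  shows "has_rank G (carrier G) 0"
proof -
  interpret comm_group G by fact
  show ?thesis using has_rank_trivial assms(1) by (simp add: trivial_group_def)
qed

lemma has_rank_integer_group: "has_rank integer_group (carrier integer_group) 1"
proof -
  interpret comm_group integer_group by (rule abelian_integer_group)
  have v: "(\<lambda>_. 1) ` {..<1::nat} \<subseteq> carrier integer_group" by simp
  have one: "zcomb integer_group (\<lambda>_. 1) c 1 = c 0" for c
  proof -
    have "zcomb integer_group (\<lambda>_. 1) c (Suc 0)
      = zcomb integer_group (\<lambda>_. 1) c 0 \<otimes>\<^bsub>integer_group\<^esub> 1 [^]\<^bsub>integer_group\<^esub> c 0"
      by (rule zcomb_Suc) simp
    then show ?thesis by (simp add: zcomb_def)
  qed
  have "m \<le> 1" if "zindep integer_group u m" for u m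
  proof (rule zindep_le_span[OF that v])
    fix i
    have "u i [^]\<^bsub>integer_group\<^esub> (1::int) = 1 * u i" by (rule group_int_pow_integer_group)
    then have "u i [^]\<^bsub>integer_group\<^esub> (1::int) = zcomb integer_group (\<lambda>_. 1) (\<lambda>_. u i) 1"
      unfolding one by simp
    then show "\<exists>k::int. \<exists>a. k \<noteq> 0 \<and> u i [^]\<^bsub>integer_group\<^esub> k = zcomb integer_group (\<lambda>_. 1) a 1"
      by (intro exI[of _ 1] exI[of _ "\<lambda>_. u i"] conjI) simp
  qed
  moreover have "zindep integer_group (\<lambda>_. 1) 1"
    unfolding zindep_def one by simp
  ultimately show ?thesis unfolding has_rank_def using v by blast
qed

section \<open>Euler characteristics of spaces with homology of finite rank\<close>

text \<open>The absolute case is \<open>S = {}\<close>. The bound \<open>N\<close> supplies the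
  vanishing in high degrees without which the sum in \<open>homology_euler\<close> would be
  meaningless.\<close>

definition has_euler :: "'a topology \<Rightarrow> 'a set \<Rightarrow> int \<Rightarrow> bool" where
  "has_euler X S e \<longleftrightarrow> (\<exists>r N.
     (\<forall>p. has_rank (relative_homology_group (int p) X S)
            (carrier (relative_homology_group (int p) X S)) (r p)) \<and>
     (\<forall>p\<ge>N. r p = 0) \<and> e = (\<Sum>p<N. (-1) ^ p * int (r p)))"

lemma alternating_sum_extend:
  assumes "\<forall>p\<ge>N. r p = 0" "N \<le> M"
  shows "(\<Sum>p<M. (-1) ^ p * int (r p)) = (\<Sum>p<N. (-1) ^ p * int (r p))"
  by (rule sum.mono_neutral_right) (use assms in auto)

lemma has_eulerI:
  assumes "\<And>p. has_rank (relative_homology_group (int p) X S)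
            (carrier (relative_homology_group (int p) X S)) (r p)"
    and "\<And>p. p \<ge> N \<Longrightarrow> r p = 0" "e = (\<Sum>p<N. (-1) ^ p * int (r p))"
  shows "has_euler X S e"
  unfolding has_euler_def using assms by blast

lemma has_eulerE:
  assumes "has_euler X S e"
  obtains r N where "\<And>p. has_rank (relative_homology_group (int p) X S)
            (carrier (relative_homology_group (int p) X S)) (r p)"
    and "\<And>p. p \<ge> N \<Longrightarrow> r p = 0" "\<And>M. M \<ge> N \<Longrightarrow> e = (\<Sum>p<M. (-1) ^ p * int (r p))"
proof -
  obtain r N where *: "\<forall>p. has_rank (relative_homology_group (int p) X S)
            (carrier (relative_homology_group (int p) X S)) (r p)"
     "\<forall>p\<ge>N. r p = 0" "e = (\<Sum>p<N. (-1) ^ p * int (r p))"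
    using assms unfolding has_euler_def by blast
  show thesis
  proof (rule that[of r N])
    show "e = (\<Sum>p<M. (-1) ^ p * int (r p))" if "M \<ge> N" for M
      using alternating_sum_extend[OF *(2) that] *(3) by simp
  qed (use *(1,2) in auto)
qed

lemma homology_euler_eq:
  assumes "has_euler X {} e"
  shows "homology_euler X = e"
proof -
  obtain r N where r: "\<And>p. has_rank (homology_group (int p) X) (carrier (homology_group (int p) X)) (r p)"
    and N: "\<And>p. p \<ge> N \<Longrightarrow> r p = 0" and e: "\<And>M. M \<ge> N \<Longrightarrow> e = (\<Sum>p<M. (-1) ^ p * int (r p))"
    by (rule has_eulerE[OF assms]) blast
  have rank: "abelian_rank (homology_group (int p) X) = r p" for p
    by (rule comm_group.abelian_rank_eq[OF abelian_homology_group r])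
  have "(\<Sum>p | r p \<noteq> 0. (-1) ^ p * int (r p)) = (\<Sum>p<N. (-1) ^ p * int (r p))"
  proof (rule sum.mono_neutral_left)
    show "{p. r p \<noteq> 0} \<subseteq> {..<N}" using N by (metis (mono_tags) lessThan_iff mem_Collect_eq not_less subsetI)
  qed auto
  then show ?thesis
    unfolding homology_euler_def rank using e[of N] by simp
qed

text \<open>Here \<open>\<alpha>\<close>, \<open>\<beta>\<close>, \<open>\<gamma>\<close> are the ranks of the three kinds of maps in a long exact sequence.\<close>

lemma alternating_sum_exact:
  assumes "\<gamma> 0 = 0" "\<gamma> N = 0"
  shows "(\<Sum>p<N. (-1) ^ p * int (\<alpha> p + \<beta> p)) =
    (\<Sum>p<N. (-1) ^ p * int (\<gamma> (Suc p) + \<alpha> p)) + (\<Sum>p<N. (-1) ^ p * int (\<beta> p + \<gamma> p))"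
proof -
  have "(\<Sum>p<N. (-1) ^ p * int (\<alpha> p + \<beta> p)) =
    (\<Sum>p<N. (-1) ^ p * int (\<gamma> (Suc p) + \<alpha> p)) + (\<Sum>p<N. (-1) ^ p * int (\<beta> p + \<gamma> p))
      - int (\<gamma> 0) + (-1) ^ N * int (\<gamma> N)"
    by (induction N) (auto simp: algebra_simps)
  then show ?thesis using assms by simp
qed

section \<open>The long exact sequence of a pair\<close>

context
  fixes X :: "'a topology" and S :: "'a set"
begin

private abbreviation "HS \<equiv> \<lambda>p. homology_group p (subtopology X S)"
private abbreviation "HX \<equiv> \<lambda>p. homology_group p X"
private abbreviation "HR \<equiv> \<lambda>p. relative_homology_group p X S"
private abbreviation "incl \<equiv> \<lambda>p. hom_induced p (subtopology X S) {} X {} id"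
private abbreviation "proj \<equiv> \<lambda>p. hom_induced p X {} X S id"
private abbreviation "bd \<equiv> \<lambda>p. hom_boundary p X S"

private lemma hom_incl: "incl p \<in> hom (HS p) (HX p)"
  and hom_proj: "proj p \<in> hom (HX p) (HR p)"
  and hom_bd: "bd p \<in> hom (HR p) (HS (p - 1))"
  by (simp_all add: hom_induced_hom hom_boundary_hom)

text \<open>Exactness indexed by the degree in which the boundary map arrives, so that only natural
  numbers occur as degrees.\<close>

private lemma kernel_incl: "kernel (HS (int p)) (HX (int p)) (incl (int p))
    = bd (int (Suc p)) ` carrier (HR (int (Suc p)))"
proof -
  have "int (Suc p) - 1 = int p" by simp
  then show ?thesis using homology_exactness_axiom_2[of "int (Suc p)" X S] by simp
qed

private lemma kernel_proj: "kernel (HX p) (HR p) (proj p) = incl p ` carrier (HS p)"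
  using homology_exactness_axiom_3[of p X S] by simp

private lemma kernel_bd: "kernel (HR p) (HS (p - 1)) (bd p) = proj p ` carrier (HX p)"
  using homology_exactness_axiom_1[of p X S] by simp

text \<open>Homology in degree -1 is trivial, so the sequence ends here; this is the boundary
  condition \<open>\<gamma> 0 = 0\<close> of the alternating sum.\<close>

private lemma rank_bd_0:
  assumes "has_rank (HS (int 0 - 1)) (bd (int 0) ` carrier (HR (int 0))) g"
  shows "g = 0"
proof -
  interpret comm_group "HS (int 0 - 1)" by (rule abelian_homology_group)
  interpret h: group_hom "HR (int 0)" "HS (int 0 - 1)" "bd (int 0)"
    using hom_bd[of "int 0"] by (simp add: group_hom_def group_hom_axioms_def)
  have "trivial_group (HS (int 0 - 1))" by (rule trivial_homology_group) simp
  then have "carrier (HS (int 0 - 1)) = {\<one>\<^bsub>HS (int 0 - 1)\<^esub>}" by (simp add: trivial_group_def)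
  moreover have "\<one>\<^bsub>HS (int 0 - 1)\<^esub> \<in> bd (int 0) ` carrier (HR (int 0))"
    using h.hom_one by (metis h.G.one_closed imageI)
  moreover have "bd (int 0) ` carrier (HR (int 0)) \<subseteq> carrier (HS (int 0 - 1))"
    using h.hom_closed by blast
  ultimately have "bd (int 0) ` carrier (HR (int 0)) = {\<one>\<^bsub>HS (int 0 - 1)\<^esub>}" by auto
  then show ?thesis using assms has_rank_trivial has_rank_unique by metis
qed

text \<open>Let \<open>\<alpha>\<close>, \<open>\<beta>\<close>, \<open>\<gamma>\<close> be the
  ranks of the images of \<open>incl\<close>, \<open>proj\<close>, \<open>bd\<close>. By exactness
  each image is the next kernel, so the ranks in degree \<open>p\<close> are
  \<open>\<gamma> (Suc p) + \<alpha> p\<close> for the subspace and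
  \<open>\<beta> p + \<gamma> p\<close> for the pair. Finite rank of the total space is a conclusion
  here, obtained by joining \<open>\<alpha>\<close> and \<open>\<beta>\<close>.\<close>

lemma has_euler_total:
  assumes "has_euler (subtopology X S) {} a" "has_euler X S c"
  shows "has_euler X {} (a + c)"
proof -
  obtain ra Na where ra: "\<And>p. has_rank (HS (int p)) (carrier (HS (int p))) (ra p)"
    and Na: "\<And>p. p \<ge> Na \<Longrightarrow> ra p = 0" and a: "\<And>M. M \<ge> Na \<Longrightarrow> a = (\<Sum>p<M. (-1) ^ p * int (ra p))"
    by (rule has_eulerE[OF assms(1)]) blast
  obtain rc Nc where rc: "\<And>p. has_rank (HR (int p)) (carrier (HR (int p))) (rc p)"
    and Nc: "\<And>p. p \<ge> Nc \<Longrightarrow> rc p = 0" and c: "\<And>M. M \<ge> Nc \<Longrightarrow> c = (\<Sum>p<M. (-1) ^ p * int (rc p))"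
    by (rule has_eulerE[OF assms(2)]) blast
  have "\<forall>p. \<exists>g \<alpha>. has_rank (HS (int p)) (bd (int (Suc p)) ` carrier (HR (int (Suc p)))) g \<and>
     has_rank (HX (int p)) (incl (int p) ` carrier (HS (int p))) \<alpha> \<and> ra p = g + \<alpha>"
    using has_rank_split[OF abelian_homology_group abelian_homology_group hom_incl ra, unfolded kernel_incl]
    by metis
  then obtain g \<alpha> where
      g: "\<And>p. has_rank (HS (int p)) (bd (int (Suc p)) ` carrier (HR (int (Suc p)))) (g p)"
    and \<alpha>: "\<And>p. has_rank (HX (int p)) (incl (int p) ` carrier (HS (int p))) (\<alpha> p)"
    and ra_eq: "\<And>p. ra p = g p + \<alpha> p"
    by metis
  have "\<forall>p. \<exists>\<beta> \<gamma>. has_rank (HR (int p)) (proj (int p) ` carrier (HX (int p))) \<beta> \<and>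
     has_rank (HS (int p - 1)) (bd (int p) ` carrier (HR (int p))) \<gamma> \<and> rc p = \<beta> + \<gamma>"
    using has_rank_split[OF abelian_relative_homology_group abelian_homology_group hom_bd rc, unfolded kernel_bd]
    by metis
  then obtain \<beta> \<gamma> where
      \<beta>: "\<And>p. has_rank (HR (int p)) (proj (int p) ` carrier (HX (int p))) (\<beta> p)"
    and \<gamma>: "\<And>p. has_rank (HS (int p - 1)) (bd (int p) ` carrier (HR (int p))) (\<gamma> p)"
    and rc_eq: "\<And>p. rc p = \<beta> p + \<gamma> p"
    by metis
  have "int (Suc p) - 1 = int p" for p by simp
  then have "g p = \<gamma> (Suc p)" for p using has_rank_unique g \<gamma>[of "Suc p"] by metis
  then have ra_eq: "\<And>p. ra p = \<gamma> (Suc p) + \<alpha> p" using ra_eq by simp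
  have \<gamma>0: "\<gamma> 0 = 0" by (rule rank_bd_0[OF \<gamma>])
  define N where "N = max Na Nc"
  show ?thesis
  proof (rule has_eulerI)
    show "has_rank (HX (int p)) (carrier (HX (int p))) (\<alpha> p + \<beta> p)" for p
      by (rule has_rank_join[OF abelian_homology_group abelian_relative_homology_group hom_proj])
        (use \<alpha> \<beta> in \<open>auto simp: kernel_proj\<close>)
    show "\<alpha> p + \<beta> p = 0" if "p \<ge> N" for p
      using Na[of p] Nc[of p] ra_eq rc_eq that by (simp add: N_def)
    have "\<gamma> N = 0" using Nc[of N] rc_eq by (simp add: N_def)
    then show "a + c = (\<Sum>p<N. (-1) ^ p * int (\<alpha> p + \<beta> p))"
      using alternating_sum_exact[of \<gamma> N \<alpha> \<beta>, OF \<gamma>0] a[of N] c[of N]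
      by (simp only: ra_eq rc_eq N_def max.cobounded1 max.cobounded2)
  qed
qed

lemma has_euler_relative:
  assumes "has_euler (subtopology X S) {} a" "has_euler X {} b"
  shows "has_euler X S (b - a)"
proof -
  obtain ra Na where ra: "\<And>p. has_rank (HS (int p)) (carrier (HS (int p))) (ra p)"
    and Na: "\<And>p. p \<ge> Na \<Longrightarrow> ra p = 0" and a: "\<And>M. M \<ge> Na \<Longrightarrow> a = (\<Sum>p<M. (-1) ^ p * int (ra p))"
    by (rule has_eulerE[OF assms(1)]) blast
  obtain rb Nb where rb: "\<And>p. has_rank (HX (int p)) (carrier (HX (int p))) (rb p)"
    and Nb: "\<And>p. p \<ge> Nb \<Longrightarrow> rb p = 0" and b: "\<And>M. M \<ge> Nb \<Longrightarrow> b = (\<Sum>p<M. (-1) ^ p * int (rb p))"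
    by (rule has_eulerE[OF assms(2)]) blast
  have "\<forall>p. \<exists>g \<alpha>. has_rank (HS (int p)) (bd (int (Suc p)) ` carrier (HR (int (Suc p)))) g \<and>
     has_rank (HX (int p)) (incl (int p) ` carrier (HS (int p))) \<alpha> \<and> ra p = g + \<alpha>"
    using has_rank_split[OF abelian_homology_group abelian_homology_group hom_incl ra, unfolded kernel_incl]
    by metis
  then obtain g \<alpha> where
      g: "\<And>p. has_rank (HS (int p)) (bd (int (Suc p)) ` carrier (HR (int (Suc p)))) (g p)"
    and \<alpha>: "\<And>p. has_rank (HX (int p)) (incl (int p) ` carrier (HS (int p))) (\<alpha> p)"
    and ra_g: "\<And>p. ra p = g p + \<alpha> p"
    by metis
  have "\<forall>p. \<exists>\<alpha> \<beta>. has_rank (HX (int p)) (incl (int p) ` carrier (HS (int p))) \<alpha> \<and>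
     has_rank (HR (int p)) (proj (int p) ` carrier (HX (int p))) \<beta> \<and> rb p = \<alpha> + \<beta>"
    using has_rank_split[OF abelian_homology_group abelian_relative_homology_group hom_proj rb, unfolded kernel_proj]
    by metis
  then obtain \<beta> where
      \<beta>: "\<And>p. has_rank (HR (int p)) (proj (int p) ` carrier (HX (int p))) (\<beta> p)"
    and rb_eq: "\<And>p. rb p = \<alpha> p + \<beta> p"
    using has_rank_unique \<alpha> by metis
  \<comment> \<open>The boundary ranks are now unknown and are recovered, shifted by one degree,
    from the kernels \<open>g\<close> of the inclusions; degree 0 has no such kernel and is filled
    in by hand.\<close>
  define \<gamma> where "\<gamma> = (\<lambda>p. case p of 0 \<Rightarrow> 0 | Suc q \<Rightarrow> g q)"
  have ra_eq: "\<And>p. ra p = \<gamma> (Suc p) + \<alpha> p" using ra_g by (simp add: \<gamma>_def)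
  have \<gamma>0: "\<gamma> 0 = 0" by (simp add: \<gamma>_def)
  have \<gamma>: "has_rank (HS (int p - 1)) (bd (int p) ` carrier (HR (int p))) (\<gamma> p)" for p
  proof (cases p)
    case 0
    have "m \<le> 0" if "zindep (HS (int 0 - 1)) v m" for v m
    proof -
      have "has_rank (HS (int 0 - 1)) (carrier (HS (int 0 - 1))) 0"
        by (intro has_rank_trivial_group trivial_homology_group abelian_homology_group) simp
      then show ?thesis using that zindep_carrier[OF that] unfolding has_rank_def by metis
    qed
    then obtain k where "has_rank (HS (int 0 - 1)) (bd (int 0) ` carrier (HR (int 0))) k"
      using has_rank_exists[of "HS (int 0 - 1)" _ 0] abelian_homology_group by metis
    moreover from this have "k = 0" by (rule rank_bd_0)
    ultimately show ?thesis using 0 \<gamma>0 by simp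
  next
    case (Suc q)
    have "int (Suc q) - 1 = int q" by simp
    then show ?thesis using g[of q] Suc by (simp only: \<gamma>_def nat.case)
  qed
  \<comment> \<open>The successor accounts for the shift: \<open>\<gamma> p\<close> is the kernel
    rank in degree \<open>p - 1\<close>.\<close>
  define N where "N = Suc (max Na Nb)"
  have N: "N \<ge> Na" "N \<ge> Nb" by (auto simp: N_def)
  have \<gamma>N: "\<gamma> p = 0" if "p \<ge> N" for p
  proof (cases p)
    case (Suc q)
    then show ?thesis using Na[of q] ra_g[of q] that by (simp add: \<gamma>_def N_def)
  qed (simp add: \<gamma>0)
  show ?thesis
  proof (rule has_eulerI)
    show "has_rank (HR (int p)) (carrier (HR (int p))) (\<beta> p + \<gamma> p)" for p
      by (rule has_rank_join[OF abelian_relative_homology_group abelian_homology_group hom_bd])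
        (use \<beta> \<gamma> in \<open>auto simp: kernel_bd\<close>)
    show "\<beta> p + \<gamma> p = 0" if "p \<ge> N" for p
      using Nb[of p] rb_eq[of p] that \<gamma>N N by simp
    show "b - a = (\<Sum>p<N. (-1) ^ p * int (\<beta> p + \<gamma> p))"
      using alternating_sum_exact[of \<gamma> N \<alpha> \<beta>, OF \<gamma>0 \<gamma>N[OF order_refl]] a[OF N(1)] b[OF N(2)]
      by (simp only: ra_eq rb_eq)
  qed
qed

end

section \<open>Excision and additivity over open covers\<close>

text \<open>The excised set is the complement of \<open>V\<close>; it is closed and contained in the
  open set \<open>U\<close>, which is what the excision axiom asks for.\<close>

lemma has_euler_excision:
  assumes "openin X U" "openin X V" "U \<union> V = topspace X"
    and "has_euler (subtopology X V) (U \<inter> V) e"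
  shows "has_euler X U e"
proof -
  let ?W = "topspace X - V"
  have V: "V \<subseteq> topspace X" "U \<subseteq> topspace X" using assms openin_subset by auto
  have "X closure_of ?W = ?W" using assms(2) by (simp add: closure_of_eq closedin_diff)
  moreover have "X interior_of U = U" using assms(1) by (simp add: interior_of_eq)
  ultimately have "X closure_of ?W \<subseteq> X interior_of U" using assms(3) by auto
  from homology_excision_axiom[OF this V(2)]
  have iso: "hom_induced p (subtopology X V) (U \<inter> V) X U id
      \<in> iso (relative_homology_group p (subtopology X V) (U \<inter> V)) (relative_homology_group p X U)" for p
  proof -
    have "topspace X - ?W = V" "U - ?W = U \<inter> V" using V by auto
    then show ?thesis
      using \<open>\<And>p. hom_induced p (subtopology X (topspace X - ?W)) (U - ?W) (subtopology X (topspace X)) U id \<in> _\<close>[of p]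
      by simp
  qed
  obtain r N where r: "\<And>p. has_rank (relative_homology_group (int p) (subtopology X V) (U \<inter> V))
        (carrier (relative_homology_group (int p) (subtopology X V) (U \<inter> V))) (r p)"
    and N: "\<And>p. p \<ge> N \<Longrightarrow> r p = 0" and e: "\<And>M. M \<ge> N \<Longrightarrow> e = (\<Sum>p<M. (-1) ^ p * int (r p))"
    by (rule has_eulerE[OF assms(4)]) blast
  show ?thesis
    by (rule has_eulerI[OF has_rank_iso[OF abelian_relative_homology_group abelian_relative_homology_group iso r] N])
      (use e in auto)
qed

text \<open>The Mayer-Vietoris sequence is replaced by two pairs: \<open>(V, U \<inter> V)\<close>
  has characteristic \<open>b - c\<close>, excision transfers this to \<open>(X, U)\<close>, and
  adding \<open>a\<close> for \<open>U\<close> gives that of \<open>X\<close>.\<close>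

lemma has_euler_Un:
  assumes UV: "openin X U" "openin X V" "U \<union> V = topspace X"
    and "has_euler (subtopology X U) {} a" "has_euler (subtopology X V) {} b"
    and "has_euler (subtopology X (U \<inter> V)) {} c"
  shows "has_euler X {} (a + b - c)"
proof -
  have "subtopology (subtopology X V) (U \<inter> V) = subtopology X (U \<inter> V)"
    by (simp add: subtopology_subtopology Int_commute Int_left_commute)
  then have "has_euler (subtopology X V) (U \<inter> V) (b - c)"
    using has_euler_relative[of "subtopology X V" "U \<inter> V" c b] assms by simp
  then have "has_euler X U (b - c)" by (rule has_euler_excision[OF UV])
  then show ?thesis using has_euler_total[OF assms(4)] by (metis add_diff_eq)
qed

lemma has_euler_empty:
  assumes "topspace X = {}"
  shows "has_euler X {} 0"
  by (rule has_eulerI[where r = "\<lambda>_. 0" and N = 0])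
    (auto intro!: has_rank_trivial_group trivial_homology_group_empty assms)

lemma has_euler_contractible:
  assumes "contractible_space X" "topspace X \<noteq> {}"
  shows "has_euler X {} 1"
proof -
  obtain a where a: "a \<in> topspace X" "X homotopy_equivalent_space (subtopology X {a})"
    using assms contractible_eq_homotopy_equivalent_singleton_subtopology[of X] by auto
  let ?Y = "subtopology X {a}"
  have Y: "topspace ?Y = {a}" using a by auto
  have iso: "homology_group p ?Y \<cong> homology_group p X" for p
    using homotopy_equivalent_space_imp_isomorphic_homology_groups[OF a(2)]
    by (simp add: group.iso_sym comm_group.axioms(2))
  have "has_rank (homology_group (int p) ?Y) (carrier (homology_group (int p) ?Y)) (if p = 0 then 1 else 0)" for p
  proof (cases "p = 0")
    case True
    have "integer_group \<cong> homology_group 0 ?Y"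
      using homology_coefficients[OF Y] by (simp add: group.iso_sym comm_group.axioms(2))
    then show ?thesis
      using has_rank_isomorphic[OF abelian_integer_group abelian_homology_group _ has_rank_integer_group] True
      by simp
  next
    case False
    then show ?thesis
      by (simp add: has_rank_trivial_group homology_dimension_axiom[OF Y])
  qed
  from has_rank_isomorphic[OF abelian_homology_group abelian_homology_group iso this]
  show ?thesis by (rule has_eulerI[where N = 1]) auto
qed

section \<open>Unions of cells\<close>

definition chains_of :: "('i \<Rightarrow> 'i \<Rightarrow> bool) \<Rightarrow> 'i set \<Rightarrow> 'i set set" where
  "chains_of below Q = {C. C \<subseteq> Q \<and> (\<forall>x\<in>C. \<forall>y\<in>C. below x y \<or> below y x)}"

text \<open>The Euler characteristic of the order complex: the empty chain is not a simplex.\<close>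

definition chain_euler :: "('i \<Rightarrow> 'i \<Rightarrow> bool) \<Rightarrow> 'i set \<Rightarrow> int" where
  "chain_euler below Q = 1 - (\<Sum>C\<in>chains_of below Q. (-1) ^ card C)"

lemma chains_of_subset: "C \<in> chains_of below Q \<Longrightarrow> D \<subseteq> C \<Longrightarrow> D \<in> chains_of below Q"
  unfolding chains_of_def by blast

lemma chains_of_mono: "C \<in> chains_of below Q \<Longrightarrow> Q \<subseteq> R \<Longrightarrow> C \<in> chains_of below R"
  unfolding chains_of_def by blast

lemma finite_chains_of: "finite Q \<Longrightarrow> finite (chains_of below Q)"
  by (rule finite_subset[of _ "Pow Q"]) (auto simp: chains_of_def)

lemma chain_euler_empty [simp]: "chain_euler below {} = 0"
proof -
  have "chains_of below {} = {{}}" by (auto simp: chains_of_def)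
  then show ?thesis by (simp add: chain_euler_def)
qed

text \<open>A chain through \<open>i\<close> is \<open>i\<close> added to a chain of elements
  comparable with \<open>i\<close>; it is one element longer and so has the opposite sign. The shape
  is that of \<open>has_euler_Un\<close>, the 1 standing for a contractible piece.\<close>

lemma chain_euler_remove:
  assumes "finite Q" "i \<in> Q" "below i i"
  shows "chain_euler below Q = chain_euler below (Q - {i}) + 1 - chain_euler below {j \<in> Q - {i}. below i j \<or> below j i}"
proof -
  let ?L = "{j \<in> Q - {i}. below i j \<or> below j i}"
  have split: "chains_of below Q = chains_of below (Q - {i}) \<union> insert i ` chains_of below ?L"
  proof (intro equalityI subsetI)
    fix C assume C: "C \<in> chains_of below Q"
    show "C \<in> chains_of below (Q - {i}) \<union> insert i ` chains_of below ?L"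
    proof (cases "i \<in> C")
      case True
      then have "C - {i} \<in> chains_of below ?L" using C by (auto simp: chains_of_def)
      moreover have "C = insert i (C - {i})" using True by auto
      ultimately show ?thesis by blast
    next
      case False
      then show ?thesis using C by (auto simp: chains_of_def)
    qed
  next
    fix C assume "C \<in> chains_of below (Q - {i}) \<union> insert i ` chains_of below ?L"
    then consider "C \<in> chains_of below (Q - {i})"
      | D where "C = insert i D" "D \<in> chains_of below ?L" by blast
    then show "C \<in> chains_of below Q"
    proof cases
      case 1
      then show ?thesis unfolding chains_of_def by blast
    next
      case 2
      have "D \<subseteq> Q" "\<And>x. x \<in> D \<Longrightarrow> below i x \<or> below x i"
        "\<And>x y. x \<in> D \<Longrightarrow> y \<in> D \<Longrightarrow> below x y \<or> below y x"
        using 2(2) by (auto simp: chains_of_def)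
      then show ?thesis
        unfolding 2(1) chains_of_def using assms(2,3) by blast
    qed
  qed
  have "(\<Sum>C\<in>chains_of below Q. (-1) ^ card C) = (\<Sum>C\<in>chains_of below (Q - {i}). (-1) ^ card C)
      + (\<Sum>C\<in>insert i ` chains_of below ?L. (-1) ^ card C :: int)"
    unfolding split
    by (rule sum.union_disjoint) (use assms(1) in \<open>auto simp: finite_chains_of chains_of_def\<close>)
  also have "(\<Sum>C\<in>insert i ` chains_of below ?L. (-1) ^ card C :: int) = (\<Sum>C\<in>chains_of below ?L. (-1) ^ card (insert i C))"
  proof (rule sum.reindex_cong[where l = "insert i"])
    show "inj_on (insert i) (chains_of below ?L)"
    proof (rule inj_onI)
      fix C D assume "C \<in> chains_of below ?L" "D \<in> chains_of below ?L" "insert i C = insert i D"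
      moreover from this have "i \<notin> C" "i \<notin> D" by (auto simp: chains_of_def)
      ultimately show "C = D" by (metis insert_ident)
    qed
  qed auto
  also have "\<dots> = (\<Sum>C\<in>chains_of below ?L. - ((-1) ^ card C))"
  proof (rule sum.cong)
    fix C assume "C \<in> chains_of below ?L"
    then have "i \<notin> C" "finite C" using assms(1) by (auto simp: chains_of_def intro: finite_subset)
    then show "(-1) ^ card (insert i C) = - ((-1 :: int) ^ card C)" by simp
  qed auto
  finally show ?thesis by (simp add: chain_euler_def sum_negf)
qed

section \<open>Spaces decomposed into cells\<close>

text \<open>The order is a parameter: inclusion for open simplices, degeneration of signs for
  arrangements. The clause on closures makes up-sets of cells relatively open; the clause on
  segments makes the star of a cell starlike.\<close>

definition cell_poset :: "('i \<Rightarrow> 'i \<Rightarrow> bool) \<Rightarrow> ('i \<Rightarrow> 'a::euclidean_space set) \<Rightarrow> 'i set \<Rightarrow> bool" where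
  "cell_poset below cell Q \<longleftrightarrow> finite Q \<and> (\<forall>i\<in>Q. cell i \<noteq> {}) \<and>
     (\<forall>i\<in>Q. \<forall>j\<in>Q. i \<noteq> j \<longrightarrow> cell i \<inter> cell j = {}) \<and>
     (\<forall>i\<in>Q. below i i) \<and>
     (\<forall>i\<in>Q. \<forall>j\<in>Q. \<forall>k\<in>Q. below i j \<longrightarrow> below j k \<longrightarrow> below i k) \<and>
     (\<forall>i\<in>Q. \<forall>j\<in>Q. cell i \<inter> closure (cell j) \<noteq> {} \<longrightarrow> below i j) \<and>
     (\<forall>i\<in>Q. \<forall>j\<in>Q. below i j \<longrightarrow> (\<forall>c\<in>cell i. \<forall>x\<in>cell j. open_segment c x \<subseteq> cell j))"

lemma cell_posetD:
  assumes "cell_poset below cell Q"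
  shows "finite Q" "\<And>i. i \<in> Q \<Longrightarrow> cell i \<noteq> {}"
    "\<And>i j. i \<in> Q \<Longrightarrow> j \<in> Q \<Longrightarrow> i \<noteq> j \<Longrightarrow> cell i \<inter> cell j = {}"
    "\<And>i. i \<in> Q \<Longrightarrow> below i i"
    "\<And>i j k. i \<in> Q \<Longrightarrow> j \<in> Q \<Longrightarrow> k \<in> Q \<Longrightarrow> below i j \<Longrightarrow> below j k \<Longrightarrow> below i k"
    "\<And>i j. i \<in> Q \<Longrightarrow> j \<in> Q \<Longrightarrow> cell i \<inter> closure (cell j) \<noteq> {} \<Longrightarrow> below i j"
    "\<And>i j c x. i \<in> Q \<Longrightarrow> j \<in> Q \<Longrightarrow> below i j \<Longrightarrow> c \<in> cell i \<Longrightarrow> x \<in> cell j \<Longrightarrow> open_segment c x \<subseteq> cell j"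
  using assms unfolding cell_poset_def by meson+

lemma cell_poset_subset:
  assumes "cell_poset below cell Q" "R \<subseteq> Q"
  shows "cell_poset below cell R"
proof -
  note D = cell_posetD[OF assms(1)]
  have sub: "\<And>i. i \<in> R \<Longrightarrow> i \<in> Q" using assms(2) by blast
  show ?thesis
    unfolding cell_poset_def
  proof (intro conjI ballI impI)
    show "finite R" using D(1) assms(2) by (rule rev_finite_subset)
  next
    fix i assume "i \<in> R"
    then show "cell i \<noteq> {}" "below i i" using D(2,4) sub by auto
  next
    fix i j assume "i \<in> R" "j \<in> R" "i \<noteq> j"
    then show "cell i \<inter> cell j = {}" by (intro D(3) sub)
  next
    fix i j assume "i \<in> R" "j \<in> R" "cell i \<inter> closure (cell j) \<noteq> {}"
    then show "below i j" by (intro D(6) sub)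
  next
    fix i j c x assume "i \<in> R" "j \<in> R" "below i j" "c \<in> cell i" "x \<in> cell j"
    then show "open_segment c x \<subseteq> cell j" by (intro D(7)[of i j] sub)
  next
    fix i j k assume "i \<in> R" "j \<in> R" "k \<in> R" "below i j" "below j k"
    then show "below i k" by (intro D(5)[of i j k] sub)
  qed
qed

text \<open>By the clause on segments, used in both directions, the midpoint of a point of one cell
  and a point of the other would lie in both.\<close>

lemma cell_poset_antisym:
  assumes P: "cell_poset below cell Q" and ij: "i \<in> Q" "j \<in> Q" "below i j" "below j i"
  shows "i = j"
proof (rule ccontr)
  assume "i \<noteq> j"
  then have disj: "cell i \<inter> cell j = {}" by (rule cell_posetD(3)[OF P ij(1,2)])
  obtain c x where cx: "c \<in> cell i" "x \<in> cell j"
    using cell_posetD(2)[OF P ij(1)] cell_posetD(2)[OF P ij(2)] by blast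
  then have "c \<noteq> x" using disj by blast
  then have "midpoint c x \<in> open_segment c x" by simp
  then have "midpoint c x \<in> cell j" "midpoint c x \<in> cell i"
    using cell_posetD(7)[OF P ij(1,2,3) cx] cell_posetD(7)[OF P ij(2,1,4) cx(2,1)]
    by (auto simp: open_segment_commute)
  then show False using disj by blast
qed

lemma cell_poset_minimal:
  assumes P: "cell_poset below cell Q" and "Q \<noteq> {}"
  obtains i where "i \<in> Q" "\<And>k. k \<in> Q \<Longrightarrow> below k i \<Longrightarrow> k = i"
proof -
  note D = cell_posetD[OF P]
  \<comment> \<open>A cell with the largest up-set is minimal: anything strictly below it would have
    that up-set and itself besides.\<close>
  let ?f = "\<lambda>i. card {j \<in> Q. below i j}"
  have "Max (?f ` Q) \<in> ?f ` Q"
    by (rule Max_in) (use assms(2) D(1) in simp_all)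
  then obtain i where i: "i \<in> Q" "Max (?f ` Q) = ?f i" by (rule imageE)
  show thesis
  proof (rule that[OF i(1)])
    fix k assume k: "k \<in> Q" "below k i"
    show "k = i"
    proof (rule ccontr)
      assume "k \<noteq> i"
      then have "\<not> below i k" using cell_poset_antisym[OF P k(1) i(1) k(2)] by blast
      moreover have "below k j" if "j \<in> Q" "below i j" for j
        using D(5)[OF k(1) i(1) that(1) k(2) that(2)] .
      ultimately have "{j \<in> Q. below i j} \<subset> {j \<in> Q. below k j}"
        using D(4)[OF k(1)] k(1) by blast
      then have "?f i < ?f k" using D(1) by (intro psubset_card_mono) auto
      moreover have "?f k \<le> Max (?f ` Q)" using D(1) k(1) by (intro Max_ge) auto
      ultimately show False using i(2) by simp
    qed
  qed
qed

lemma starlike_cell_star: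
  assumes P: "cell_poset below cell Q" and i: "i \<in> Q"
  shows "starlike (\<Union>j\<in>{j \<in> Q. below i j}. cell j)"
proof -
  obtain c where c: "c \<in> cell i" using cell_posetD(2)[OF P i] by blast
  have "closed_segment c x \<subseteq> (\<Union>j\<in>{j \<in> Q. below i j}. cell j)" if "j \<in> Q" "below i j" "x \<in> cell j" for j x
  proof -
    have "open_segment c x \<subseteq> cell j" using cell_posetD(7)[OF P i that(1,2) c that(3)] .
    then show ?thesis
      using that c i cell_posetD(4)[OF P i] by (auto simp: closed_segment_eq_open)
  qed
  then show ?thesis
    unfolding starlike_def using c i cell_posetD(4)[OF P i] by blast
qed

text \<open>Removing a minimal cell leaves an open set; the star of the cell is a contractible open set.\<close>

theorem has_euler_cells:
  fixes cell :: "'i \<Rightarrow> 'a::euclidean_space set"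
  assumes "cell_poset below cell Q"
  shows "has_euler (top_of_set (\<Union>i\<in>Q. cell i)) {} (chain_euler below Q)"
  using assms
proof (induction "card Q" arbitrary: Q rule: less_induct)
  case less
  note P = less.prems
  note D = cell_posetD[OF P]
  show ?case
  proof (cases "Q = {}")
    case True
    then show ?thesis using has_euler_empty[of "top_of_set {}"] by simp
  next
    case False
    then obtain i where i: "i \<in> Q" and min: "\<And>k. k \<in> Q \<Longrightarrow> below k i \<Longrightarrow> k = i"
      using cell_poset_minimal[OF P] by metis
    define A where "A = Q - {i}"
    define B where "B = {j \<in> Q. below i j}"
    \<comment> \<open>Phrased with both directions to match \<open>chain_euler_remove\<close>; by
      minimality of \<open>i\<close> only the cells strictly above \<open>i\<close> remain, which
      makes \<open>C\<close> the overlap of \<open>A\<close> and \<open>B\<close>.\<close>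
    define C where "C = {j \<in> Q - {i}. below i j \<or> below j i}"
    let ?U = "\<lambda>R. \<Union>j\<in>R. cell j"
    let ?X = "top_of_set (?U Q)"
    have ABC: "A \<subseteq> Q" "B \<subseteq> Q" "C \<subseteq> Q" "A \<inter> B = C" "A \<union> B = Q"
      using min D(4)[OF i] i by (auto simp: A_def B_def C_def)
    have "j = k" if "j \<in> A" "k \<in> B" "x \<in> cell j" "x \<in> cell k" for j k x
      using D(3)[of j k] that ABC(1,2) by (metis IntI empty_iff subsetD)
    then have "?U A \<inter> ?U B = ?U (A \<inter> B)" by fast
    then have Int: "?U A \<inter> ?U B = ?U C" using ABC(4) by simp
    have "card A < card Q" "card C < card Q"
      by (rule psubset_card_mono[OF D(1)]; use i in \<open>auto simp: A_def C_def\<close>)+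
    then have IH: "has_euler (top_of_set (?U A)) {} (chain_euler below A)"
      "has_euler (top_of_set (?U C)) {} (chain_euler below C)"
      by (auto intro!: less.hyps cell_poset_subset[OF P] ABC)
    have contr: "has_euler (top_of_set (?U B)) {} 1"
    proof (rule has_euler_contractible)
      show "contractible_space (top_of_set (?U B))"
        using starlike_imp_contractible[OF starlike_cell_star[OF P i]] by (simp add: B_def)
      show "topspace (top_of_set (?U B)) \<noteq> {}"
        using D(2,4)[OF i] i by (auto simp: B_def)
    qed
    \<comment> \<open>The removed cells have finitely many closures, and none of them meets a cell
      of the up-set \<open>R\<close>; so \<open>R\<close> is cut out by the complement of a closed
      set.\<close>
    have opn: "openin ?X (?U R)" if R: "R \<subseteq> Q" and up: "\<And>j k. j \<in> Q - R \<Longrightarrow> k \<in> R \<Longrightarrow> \<not> below k j" for R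
    proof -
      have "finite (Q - R)" using D(1) by simp
      then have "closed (\<Union>j\<in>Q - R. closure (cell j))" by (intro closed_UN) auto
      moreover have "?U R = ?U Q - (\<Union>j\<in>Q - R. closure (cell j))"
      proof
        show "?U R \<subseteq> ?U Q - (\<Union>j\<in>Q - R. closure (cell j))"
        proof
          fix x assume "x \<in> ?U R"
          then obtain k where k: "k \<in> R" "x \<in> cell k" by blast
          have "x \<notin> closure (cell j)" if "j \<in> Q - R" for j
            using D(6)[of k j] up[OF that k(1)] k that R by (metis DiffD1 IntI empty_iff subsetD)
          then show "x \<in> ?U Q - (\<Union>j\<in>Q - R. closure (cell j))" using k R by blast
        qed
        show "?U Q - (\<Union>j\<in>Q - R. closure (cell j)) \<subseteq> ?U R"
          using closure_subset by blast
      qed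
      ultimately show ?thesis
        by (metis Diff_eq open_Compl openin_open)
    qed
    have "openin ?X (?U A)"
      by (rule opn) (use min i in \<open>auto simp: A_def\<close>)
    moreover have "openin ?X (?U B)"
    proof (rule opn[OF ABC(2)])
      fix j k assume jk: "j \<in> Q - B" "k \<in> B"
      then show "\<not> below k j" using D(5)[of i k j] i by (auto simp: B_def)
    qed
    moreover have "?U A \<union> ?U B = topspace ?X" using ABC(5) by auto
    moreover have "subtopology ?X (?U R) = top_of_set (?U R)" if "R \<subseteq> Q" for R
    proof -
      have "?U Q \<inter> ?U R = ?U R" using that by blast
      then show ?thesis by (simp add: subtopology_subtopology)
    qed
    ultimately have "has_euler ?X {} (chain_euler below A + 1 - chain_euler below C)"
      using has_euler_Un[of ?X "?U A" "?U B" "chain_euler below A" 1 "chain_euler below C"]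
        IH contr ABC(1,2,3) unfolding Int by simp
    then show ?thesis
      using chain_euler_remove[OF D(1) i, of below] D(4)[OF i] by (simp add: A_def C_def)
  qed
qed

section \<open>Simplicial complexes\<close>

lemma simplicial_complexD:
  assumes "simplicial_complex K"
  shows "finite K" "\<And>S. S \<in> K \<Longrightarrow> \<exists>n. n simplex S"
    "\<And>S F. S \<in> K \<Longrightarrow> F face_of S \<Longrightarrow> F \<in> K"
    "\<And>S T. S \<in> K \<Longrightarrow> T \<in> K \<Longrightarrow> (S \<inter> T) face_of S"
  using assms unfolding simplicial_complex_def by auto

lemma simplicial_complex_closed:
  assumes "simplicial_complex K" "S \<in> K"
  shows "convex S" "closed S" "polytope S"
  using simplicial_complexD(2)[OF assms] convex_simplex closed_simplex simplex_imp_polytope by blast+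

lemma simplicial_complex_vertices:
  assumes "simplicial_complex K" "S \<in> K"
  obtains V where "\<not> affine_dependent V" "finite V" "S = convex hull V" "simplex_vertices S = V"
proof -
  obtain V where V: "\<not> affine_dependent V" "S = convex hull V"
    using simplicial_complexD(2)[OF assms] unfolding simplex_def by blast
  moreover have "simplex_vertices S = V"
    using V by (simp add: simplex_vertices_def extreme_point_of_convex_hull_affine_independent)
  ultimately show thesis using that aff_independent_finite by blast
qed

text \<open>\<open>S \<inter> T\<close> is a face of \<open>S\<close> that meets the relative
  interior of \<open>S\<close>, and only \<open>S\<close> itself is such a face.\<close>

lemma simplicial_complex_subset:
  assumes K: "simplicial_complex K" and "S \<in> K" "T \<in> K" "rel_interior S \<inter> T \<noteq> {}"
  shows "S \<subseteq> T"
proof -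
  have "S \<inter> T \<inter> rel_interior S \<noteq> {}" using assms(4) rel_interior_subset by blast
  from subset_of_face_of[OF simplicial_complexD(4)[OF K assms(2,3)] order_refl this]
  show ?thesis by blast
qed

lemma simplicial_complex_face:
  assumes "simplicial_complex K" "S \<in> K" "T \<in> K" "S \<subseteq> T"
  shows "S face_of T"
  using simplicial_complexD(4)[OF assms(1,3,2)] assms(4) by (simp add: Int_absorb1)

lemma simplicial_complex_rel_interior_disjoint:
  assumes "simplicial_complex K" "S \<in> K" "T \<in> K" "x \<in> rel_interior S" "x \<in> rel_interior T"
  shows "S = T"
proof -
  have "rel_interior S \<inter> T \<noteq> {}" "rel_interior T \<inter> S \<noteq> {}"
    using assms(4,5) rel_interior_subset by blast+
  then show ?thesis using simplicial_complex_subset[OF assms(1)] assms(2,3) by blast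
qed

text \<open>Take a minimal simplex containing \<open>x\<close>: if \<open>x\<close> were on its
  relative boundary, a facet through \<open>x\<close> would be a smaller one.\<close>

lemma simplicial_complex_rel_interior:
  assumes K: "simplicial_complex K" and "x \<in> \<Union>K"
  obtains S where "S \<in> K - {{}}" "x \<in> rel_interior S"
proof -
  let ?A = "{S \<in> K. x \<in> S}"
  have "finite ?A" "?A \<noteq> {}" using simplicial_complexD(1)[OF K] assms(2) by auto
  then obtain S where S: "S \<in> ?A" and min: "\<And>T. T \<in> ?A \<Longrightarrow> T \<le> S \<Longrightarrow> S = T"
    using finite_has_minimal[of ?A] by metis
  have SK: "S \<in> K" "x \<in> S" using S by auto
  have "x \<in> rel_interior S"
  proof (rule ccontr)
    assume "x \<notin> rel_interior S"
    moreover have "polyhedron S"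
      using simplicial_complex_closed(3)[OF K SK(1)] by (rule polytope_imp_polyhedron)
    ultimately obtain F where F: "F facet_of S" "x \<in> F"
      using rel_boundary_of_polyhedron[of S] SK(2) by blast
    then have "F face_of S" "F \<noteq> S" by (auto simp: facet_of_def)
    then show False
      using min[of F] simplicial_complexD(3)[OF K SK(1)] F(2) face_of_imp_subset by blast
  qed
  then show thesis using that SK by blast
qed

lemma cell_poset_simplicial_complex:
  assumes K: "simplicial_complex K"
  shows "cell_poset (\<subseteq>) rel_interior (K - {{}})"
  unfolding cell_poset_def
proof (intro conjI ballI impI)
  show "finite (K - {{}})" using simplicial_complexD(1)[OF K] by simp
next
  fix S assume "S \<in> K - {{}}"
  then show "rel_interior S \<noteq> {}"
    using simplicial_complex_closed(1)[OF K] by (simp add: rel_interior_eq_empty)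
next
  fix S T assume "S \<in> K - {{}}" "T \<in> K - {{}}" "S \<noteq> T"
  then show "rel_interior S \<inter> rel_interior T = {}"
    using simplicial_complex_rel_interior_disjoint[OF K, of S T] by blast
next
  fix S T assume ST: "S \<in> K - {{}}" "T \<in> K - {{}}" "rel_interior S \<inter> closure (rel_interior T) \<noteq> {}"
  have "closure (rel_interior T) \<subseteq> T"
    using simplicial_complex_closed(2)[OF K, of T] ST(2) rel_interior_subset
    by (metis DiffD1 closure_minimal)
  then show "S \<subseteq> T" using simplicial_complex_subset[OF K, of S T] ST by blast
next
  fix S T c x assume ST: "S \<in> K - {{}}" "T \<in> K - {{}}" "S \<subseteq> T"
    and c: "c \<in> rel_interior S" and x: "x \<in> rel_interior T"
  have "c \<in> closure T" using c ST rel_interior_subset closure_subset by blast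
  then have "open_segment x c \<subseteq> rel_interior T"
    using rel_interior_closure_convex_segment[OF _ x] simplicial_complex_closed(1)[OF K] ST by blast
  then show "open_segment c x \<subseteq> rel_interior T" by (simp add: open_segment_commute)
qed auto

section \<open>Alternating sums over simplices\<close>

lemma sum_neg_one_Pow:
  assumes "finite V" "V \<noteq> {}"
  shows "(\<Sum>c\<in>Pow V. (-1) ^ card c) = (0::int)"
proof -
  have "(\<Prod>x\<in>V. (1::int) - 1) = (\<Sum>c\<in>Pow V. (-1) ^ card c * (\<Prod>x\<in>c. 1) * (\<Prod>x\<in>V - c. 1))"
    by (rule prod_diff_conv_sum) (fact assms(1))
  moreover have "(\<Prod>x\<in>V. (1::int) - 1) = 0" using assms by (simp add: power_0_left)
  ultimately show ?thesis by simp
qed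

text \<open>This includes the empty hull: \<open>nat\<close> truncates its dimension -1 to 0, and
  \<open>0 - 1\<close> is 0 on natural numbers.\<close>

lemma nat_aff_dim_convex_hull:
  assumes "\<not> affine_dependent V"
  shows "nat (aff_dim (convex hull V)) = card V - 1"
  using assms by (auto simp: aff_dim_convex_hull affine_independent_iff_card)

lemma neg_one_aff_dim:
  assumes "\<not> affine_dependent V" "V \<noteq> {}"
  shows "(-1) ^ nat (aff_dim (convex hull V)) = - ((-1 :: int) ^ card V)"
proof -
  have "card V \<noteq> 0" using assms(2) aff_independent_finite[OF assms(1)] by simp
  then obtain n where "card V = Suc n" by (metis not0_implies_Suc)
  then show ?thesis by (simp add: nat_aff_dim_convex_hull[OF assms(1)])
qed

text \<open>The faces are the hulls of subsets of \<open>V\<close>. The signed sum over all subsets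
  vanishes, so leaving out the empty one produces 1.\<close>

lemma simplex_face_sum:
  assumes V: "\<not> affine_dependent V" "V \<noteq> {}"
  shows "(\<Sum>F | F face_of (convex hull V) \<and> F \<noteq> {}. (-1) ^ nat (aff_dim F)) = (1::int)"
proof -
  have fin: "finite V" using V aff_independent_finite by blast
  have indep: "\<not> affine_dependent c" if "c \<subseteq> V" for c
    using V that affine_dependent_subset by blast
  have inj: "inj_on (\<lambda>c. convex hull c) (Pow V - {{}})"
  proof (rule inj_onI)
    fix c d assume "c \<in> Pow V - {{}}" "d \<in> Pow V - {{}}" and eq: "convex hull c = convex hull d"
    then have "\<not> affine_dependent c" "\<not> affine_dependent d" using indep by auto
    then show "c = d"
      using eq by (metis extreme_point_of_convex_hull_affine_independent subsetI subset_antisym)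
  qed
  have "{F. F face_of (convex hull V) \<and> F \<noteq> {}} = (\<lambda>c. convex hull c) ` (Pow V - {{}})"
    by (auto simp: face_of_convex_hull_affine_independent[OF V(1)])
  then have "(\<Sum>F | F face_of (convex hull V) \<and> F \<noteq> {}. (-1) ^ nat (aff_dim F))
      = (\<Sum>c\<in>Pow V - {{}}. (-1) ^ nat (aff_dim (convex hull c)) :: int)"
    by (simp add: sum.reindex[OF inj])
  also have "\<dots> = (\<Sum>c\<in>Pow V - {{}}. - ((-1) ^ card c))"
    by (rule sum.cong) (use neg_one_aff_dim indep in auto)
  also have "\<dots> = 1"
    using sum_neg_one_Pow[OF fin V(2)] fin by (simp add: sum_negf sum_diff1)
  finally show ?thesis .
qed

text \<open>Remove a maximal simplex \<open>S\<close>: the elements comparable with it are its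
  proper nonempty faces, which by induction and \<open>simplex_face_sum\<close> contribute
  \<open>1 - (-1) ^ nat (aff_dim S)\<close>. So the order complex changes by exactly the term of
  \<open>S\<close>.\<close>

lemma chain_euler_face_closed:
  assumes K: "simplicial_complex K" and "Q \<subseteq> K - {{}}"
    and "\<And>S F. S \<in> Q \<Longrightarrow> F face_of S \<Longrightarrow> F \<noteq> {} \<Longrightarrow> F \<in> Q"
  shows "chain_euler (\<subseteq>) Q = (\<Sum>S\<in>Q. (-1) ^ nat (aff_dim S))"
  using assms(2,3)
proof (induction "card Q" arbitrary: Q rule: less_induct)
  case less
  have fin: "finite Q" using less.prems(1) simplicial_complexD(1)[OF K] by (auto intro: finite_subset)
  show ?case
  proof (cases "Q = {}")
    case False
    then obtain S where S: "S \<in> Q" and max: "\<And>T. T \<in> Q \<Longrightarrow> S \<subseteq> T \<Longrightarrow> S = T"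
      using finite_has_maximal[OF fin] by metis
    have SK: "S \<in> K" "S \<noteq> {}" using S less.prems(1) by auto
    define L where "L = {T \<in> Q - {S}. S \<subseteq> T \<or> T \<subseteq> S}"
    have L: "L = {F. F face_of S \<and> F \<noteq> {}} - {S}"
    proof (intro equalityI subsetI)
      fix T assume "T \<in> L"
      then have T: "T \<in> Q" "T \<noteq> S" "T \<subseteq> S" using max by (auto simp: L_def)
      then show "T \<in> {F. F face_of S \<and> F \<noteq> {}} - {S}"
        using simplicial_complex_face[OF K _ SK(1)] less.prems(1) by auto
    next
      fix T assume "T \<in> {F. F face_of S \<and> F \<noteq> {}} - {S}"
      then show "T \<in> L" using less.prems(2)[OF S] face_of_imp_subset by (auto simp: L_def)
    qed
    obtain V where V: "\<not> affine_dependent V" "S = convex hull V"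
      using simplicial_complex_vertices[OF K SK(1)] by metis
    have "V \<noteq> {}" using SK V by auto
    have face_sum: "(\<Sum>F | F face_of S \<and> F \<noteq> {}. (-1) ^ nat (aff_dim F)) = (1::int)"
      using simplex_face_sum[OF V(1) \<open>V \<noteq> {}\<close>] V(2) by simp
    have LQ: "L \<subset> Q" using S by (auto simp: L_def)
    have "chain_euler (\<subseteq>) L = (\<Sum>S\<in>L. (-1) ^ nat (aff_dim S))"
    proof (rule less.hyps)
      show "card L < card Q" using LQ fin by (rule psubset_card_mono[rotated])
      show "L \<subseteq> K - {{}}" using LQ less.prems(1) by blast
      fix T F assume "T \<in> L" "F face_of T" "F \<noteq> {}"
      then show "F \<in> L"
        unfolding L using face_of_trans[of F T S] face_of_imp_subset by blast
    qed
    also have "\<dots> = 1 - (-1) ^ nat (aff_dim S)"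
    proof -
      have "finite {F. F face_of S \<and> F \<noteq> {}}"
        by (rule finite_subset[OF _ simplicial_complexD(1)[OF K]])
          (use simplicial_complexD(3)[OF K SK(1)] in auto)
      moreover have "S \<in> {F. F face_of S \<and> F \<noteq> {}}"
        using SK simplicial_complex_closed(1)[OF K] by (simp add: face_of_refl)
      ultimately show ?thesis unfolding L using face_sum by (simp add: sum_diff1)
    qed
    finally have 1: "chain_euler (\<subseteq>) L = 1 - (-1) ^ nat (aff_dim S)" .
    have 2: "chain_euler (\<subseteq>) (Q - {S}) = (\<Sum>S\<in>Q - {S}. (-1) ^ nat (aff_dim S))"
    proof (rule less.hyps)
      show "card (Q - {S}) < card Q" using fin S by (rule card_Diff1_less)
      show "Q - {S} \<subseteq> K - {{}}" using less.prems(1) by blast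
      fix T F assume "T \<in> Q - {S}" "F face_of T" "F \<noteq> {}"
      then show "F \<in> Q - {S}"
        using less.prems(2)[of T F] max[of T] face_of_imp_subset by blast
    qed
    show ?thesis
      using chain_euler_remove[OF fin S, of "(\<subseteq>)"] 1 2 sum.remove[OF fin S, of "\<lambda>S. (-1 :: int) ^ nat (aff_dim S)"]
      by (simp add: L_def)
  qed simp
qed

text \<open>Simplices are regrouped by dimension. \<open>nat\<close> would count the empty simplex
  in dimension 0, so \<open>{}\<close> has to be removed from the range of summation.\<close>

lemma complex_euler_sum:
  fixes K :: "'a::euclidean_space set set"
  assumes K: "simplicial_complex K"
  shows "complex_euler K = (\<Sum>S\<in>K - {{}}. (-1) ^ nat (aff_dim S))"
proof -
  let ?g = "\<lambda>S::'a set. nat (aff_dim S)"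
  have fin: "finite (K - {{}})" using simplicial_complexD(1)[OF K] by simp
  have eq: "{S \<in> K. int m simplex S} = {S \<in> K - {{}}. ?g S = m}" for m
  proof -
    have "int m simplex S \<longleftrightarrow> S \<noteq> {} \<and> ?g S = m" if SK: "S \<in> K" for S
    proof -
      obtain n where n: "n simplex S" using simplicial_complexD(2)[OF K SK] by blast
      then have dim: "aff_dim S = n" by (rule aff_dim_simplex)
      show ?thesis
      proof
        assume "int m simplex S"
        then show "S \<noteq> {} \<and> ?g S = m" using aff_dim_simplex by fastforce
      next
        assume S: "S \<noteq> {} \<and> ?g S = m"
        then have "aff_dim S \<noteq> -1" by (simp add: aff_dim_empty)
        then have "n = int m" using S simplex_dim_ge[OF n] dim by auto
        then show "int m simplex S" using n by simp
      qed
    qed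
    then show ?thesis by auto
  qed
  have "complex_euler K = (\<Sum>m\<le>DIM('a). \<Sum>S | S \<in> K - {{}} \<and> ?g S = m. (-1) ^ ?g S)"
    unfolding complex_euler_def eq
  proof (rule sum.cong)
    fix m
    have "(\<Sum>S | S \<in> K - {{}} \<and> ?g S = m. (-1) ^ ?g S :: int) = (\<Sum>S | S \<in> K - {{}} \<and> ?g S = m. (-1) ^ m)"
      by (rule sum.cong) auto
    then show "(-1) ^ m * int (card {S \<in> K - {{}}. ?g S = m}) = (\<Sum>S | S \<in> K - {{}} \<and> ?g S = m. (-1) ^ ?g S)"
      by simp
  qed simp
  also have "\<dots> = (\<Sum>S\<in>K - {{}}. (-1) ^ ?g S)"
  proof (rule sum.group[OF fin])
    show "?g ` (K - {{}}) \<subseteq> {..DIM('a)}"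
      by (auto simp: nat_le_iff aff_dim_le_DIM)
  qed simp
  finally show ?thesis .
qed

lemma complex_euler_eq_chain_euler:
  assumes K: "simplicial_complex K"
  shows "complex_euler K = chain_euler (\<subseteq>) (K - {{}})"
  unfolding complex_euler_sum[OF K]
  by (rule chain_euler_face_closed[OF K, symmetric]) (use simplicial_complexD(3)[OF K] in auto)

lemma has_euler_open_simplices:
  assumes K: "simplicial_complex K" and "Q \<subseteq> K - {{}}"
  shows "has_euler (top_of_set (\<Union>S\<in>Q. rel_interior S)) {} (chain_euler (\<subseteq>) Q)"
  by (rule has_euler_cells[OF cell_poset_subset[OF cell_poset_simplicial_complex[OF K] assms(2)]])

lemma has_euler_simplicial_complex:
  assumes K: "simplicial_complex K"
  shows "has_euler (top_of_set (\<Union>K)) {} (complex_euler K)"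
proof -
  have "(\<Union>S\<in>K - {{}}. rel_interior S) = \<Union>K"
  proof
    show "(\<Union>S\<in>K - {{}}. rel_interior S) \<subseteq> \<Union>K" using rel_interior_subset by fastforce
    show "\<Union>K \<subseteq> (\<Union>S\<in>K - {{}}. rel_interior S)"
    proof
      fix x assume "x \<in> \<Union>K"
      then show "x \<in> (\<Union>S\<in>K - {{}}. rel_interior S)"
        using simplicial_complex_rel_interior[OF K, of x] by (metis UN_I)
    qed
  qed
  then show ?thesis
    using has_euler_open_simplices[OF K order_refl] by (simp add: complex_euler_eq_chain_euler[OF K])
qed

text \<open>The triangulation picked by \<open>SOME\<close> and \<open>K\<close> compute the same
  homological number of the same space.\<close>

lemma polyhedron_euler_eq:
  assumes K: "simplicial_complex K"
  shows "polyhedron_euler (\<Union>K) = complex_euler K"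
proof -
  have "triangulates K (\<Union>K)" using K by (simp add: triangulates_def)
  then have "triangulates (SOME K'. triangulates K' (\<Union>K)) (\<Union>K)" by (rule someI)
  then have "has_euler (top_of_set (\<Union>K)) {} (polyhedron_euler (\<Union>K))"
    unfolding polyhedron_euler_def triangulates_def using has_euler_simplicial_complex by metis
  then show ?thesis
    using homology_euler_eq has_euler_simplicial_complex[OF K] by metis
qed

section \<open>Flags of barycenters\<close>

context
  fixes K :: "'a::euclidean_space set set"
  assumes K: "simplicial_complex K"
begin

lemma barycenter_in_rel_interior:
  assumes "S \<in> K - {{}}"
  shows "barycenter S \<in> rel_interior S"
proof -
  obtain V where V: "\<not> affine_dependent V" "finite V" "S = convex hull V" "simplex_vertices S = V"
    using simplicial_complex_vertices[OF K, of S] assms by blast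
  have "V \<noteq> {}" using V(3) assms by auto
  then have "card V > 0" using V(2) by (simp add: card_gt_0_iff)
  then show ?thesis
    unfolding V(3) rel_interior_convex_hull_explicit[OF V(1)]
    unfolding V(3)[symmetric] barycenter_def V(4)
    by (intro CollectI exI[of _ "\<lambda>_. 1 / real (card V)"]) (auto simp: scaleR_sum_right)
qed

lemma flag_hull_subset:
  assumes "C \<subseteq> K - {{}}" "\<And>T. T \<in> C \<Longrightarrow> T \<subseteq> S" "convex S"
  shows "convex hull (barycenter ` C) \<subseteq> S"
  using barycenter_in_rel_interior assms rel_interior_subset by (intro hull_minimal) blast+

lemma flag_top:
  assumes "C \<in> chains_of (\<subseteq>) (K - {{}})" "C \<noteq> {}"
  obtains S where "S \<in> C" "\<And>T. T \<in> C \<Longrightarrow> T \<subseteq> S"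
proof -
  have "finite C"
    using assms(1) simplicial_complexD(1)[OF K] by (auto simp: chains_of_def intro: finite_subset)
  then obtain S where S: "S \<in> C" and max: "\<And>T. T \<in> C \<Longrightarrow> S \<subseteq> T \<Longrightarrow> S = T"
    using finite_has_maximal assms(2) by metis
  have "T \<subseteq> S" if "T \<in> C" for T
  proof -
    have "S \<subseteq> T \<or> T \<subseteq> S" using assms(1) S that by (simp add: chains_of_def)
    then show ?thesis using max[OF that] by auto
  qed
  then show thesis using that S by metis
qed

text \<open>The whole hull lies in the top member of the flag, which is a proper face of
  \<open>S\<close>.\<close>

lemma flag_hull_subset_rel_frontier:
  assumes C: "C \<in> chains_of (\<subseteq>) (K - {{}})" and S: "S \<in> K" "S \<notin> C" "\<And>T. T \<in> C \<Longrightarrow> T \<subseteq> S"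
  shows "convex hull (barycenter ` C) \<subseteq> rel_frontier S"
proof (cases "C = {}")
  case False
  then obtain T where T: "T \<in> C" "\<And>U. U \<in> C \<Longrightarrow> U \<subseteq> T" using flag_top[OF C] by metis
  have CK: "C \<subseteq> K - {{}}" using C by (simp add: chains_of_def)
  have TK: "T \<in> K" "T \<noteq> S" "T \<subseteq> S" using T(1) CK S by auto
  have "T \<subseteq> rel_frontier S"
    by (rule face_of_subset_rel_frontier[OF simplicial_complex_face[OF K TK(1) S(1) TK(3)] TK(2)])
  moreover have "convex hull (barycenter ` C) \<subseteq> T"
    by (rule flag_hull_subset[OF CK T(2) simplicial_complex_closed(1)[OF K TK(1)]])
  ultimately show ?thesis by blast
qed simp

text \<open>Every point of the hull lies on a segment from the barycenter of \<open>S\<close> to a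
  point \<open>y\<close> of the hull of the rest. As the barycenter is in the relative interior of
  \<open>S\<close>, only the end \<open>y\<close> can be outside of it.\<close>

lemma flag_hull_remove_top:
  assumes C: "C \<in> chains_of (\<subseteq>) (K - {{}})" and S: "S \<in> C" "\<And>T. T \<in> C \<Longrightarrow> T \<subseteq> S"
    and x: "x \<in> convex hull (barycenter ` C)" "x \<notin> rel_interior S"
  shows "x \<in> convex hull (barycenter ` (C - {S}))"
proof -
  let ?H = "convex hull (barycenter ` (C - {S}))"
  have CK: "C \<subseteq> K - {{}}" using C by (simp add: chains_of_def)
  have conv: "convex S" using simplicial_complex_closed(1)[OF K] S CK by blast
  have b: "barycenter S \<in> rel_interior S" using barycenter_in_rel_interior S CK by blast
  have C_eq: "barycenter ` C = insert (barycenter S) (barycenter ` (C - {S}))" using S by blast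
  have "C - {S} \<noteq> {}"
  proof
    assume "C - {S} = {}"
    then have "barycenter ` C = {barycenter S}" using C_eq by (metis image_empty)
    then have "x = barycenter S" using x(1) by simp
    then show False using b x(2) by simp
  qed
  then obtain y where y: "y \<in> ?H" "x \<in> closed_segment (barycenter S) y"
    using x(1) unfolding C_eq convex_hull_insert_segments by (auto split: if_splits)
  have "y \<in> S" using y(1) flag_hull_subset[of "C - {S}" S] CK S conv by blast
  then have "open_segment (barycenter S) y \<subseteq> rel_interior S"
    by (intro rel_interior_closure_convex_segment[OF conv b]) (use closure_subset in blast)
  then have "x = y" using y(2) x(2) b unfolding closed_segment_eq_open by blast
  then show ?thesis using y(1) by simp
qed

text \<open>By induction on the lengths: if the tops differ, a common point avoids the relative interior of
  one of them, which can be dropped; if both are \<open>S\<close>, each ray from the barycenter of \<open>S\<close> meets the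
  relative frontier of \<open>S\<close> only once.\<close>

lemma flag_hull_Int:
  assumes "C \<in> chains_of (\<subseteq>) (K - {{}})" "D \<in> chains_of (\<subseteq>) (K - {{}})"
  shows "convex hull (barycenter ` C) \<inter> convex hull (barycenter ` D) = convex hull (barycenter ` (C \<inter> D))"
  using assms
proof (induction "card C + card D" arbitrary: C D rule: less_induct)
  case less
  have sub: "C \<subseteq> K - {{}}" "D \<subseteq> K - {{}}" using less.prems by (auto simp: chains_of_def)
  have fin: "finite C" "finite D"
    using sub simplicial_complexD(1)[OF K] by (auto intro: finite_subset)
  let ?H = "\<lambda>C. convex hull (barycenter ` C)"
  have chain_mono: "C' \<in> chains_of (\<subseteq>) (K - {{}})" if "C' \<subseteq> C \<or> C' \<subseteq> D" for C'
    using that chains_of_subset[OF less.prems(1)] chains_of_subset[OF less.prems(2)] by metis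
  have mono: "?H (C \<inter> D) \<subseteq> ?H C \<inter> ?H D"
    by (simp add: hull_mono image_mono)
  show ?case
  proof (cases "C = {} \<or> D = {}")
    case True
    then show ?thesis by auto
  next
    case False
    obtain S where S: "S \<in> C" "\<And>T. T \<in> C \<Longrightarrow> T \<subseteq> S" using flag_top[OF less.prems(1)] False by metis
    obtain T where T: "T \<in> D" "\<And>U. U \<in> D \<Longrightarrow> U \<subseteq> T" using flag_top[OF less.prems(2)] False by metis
    have STK: "S \<in> K" "T \<in> K" using S T sub by auto
    have HS: "?H C \<subseteq> S" using flag_hull_subset[OF sub(1) S(2)] simplicial_complex_closed(1)[OF K STK(1)] by blast
    have HT: "?H D \<subseteq> T" using flag_hull_subset[OF sub(2) T(2)] simplicial_complex_closed(1)[OF K STK(2)] by blast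
    have cards: "card (C - {S}) < card C" "card (D - {T}) < card D"
      using card_Diff1_less[OF fin(1) S(1)] card_Diff1_less[OF fin(2) T(1)] by simp_all
    consider "S = T" | "\<not> S \<subseteq> T" | "\<not> T \<subseteq> S" by blast
    then show ?thesis
    proof cases
      case 1
      let ?C = "C - {S}" and ?D = "D - {S}"
      have CD: "?C \<in> chains_of (\<subseteq>) (K - {{}})" "?D \<in> chains_of (\<subseteq>) (K - {{}})"
        by (auto intro: chain_mono)
      have IH: "?H ?C \<inter> ?H ?D = ?H (?C \<inter> ?D)"
        by (rule less.hyps[OF _ CD]) (use cards 1 in simp)
      have ins: "?H (insert S E) = convex hull (insert (barycenter S) (?H E))" for E
        unfolding image_insert by (rule hull_insert)
      have "?H C \<inter> ?H D = ?H (insert S ?C) \<inter> ?H (insert S ?D)"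
        using S T 1 by (simp add: insert_absorb)
      also have "\<dots> = convex hull (insert (barycenter S) (?H ?C \<inter> ?H ?D))"
        unfolding ins
      proof (rule convex_hull_insert_Int_eq)
        show "barycenter S \<in> rel_interior S" using barycenter_in_rel_interior S sub by blast
        show "?H ?C \<subseteq> rel_frontier S"
          by (rule flag_hull_subset_rel_frontier[OF CD(1) STK(1)]) (use S in auto)
        show "?H ?D \<subseteq> rel_frontier S"
          by (rule flag_hull_subset_rel_frontier[OF CD(2) STK(1)]) (use T 1 in auto)
      qed (use simplicial_complex_closed(1)[OF K STK(1)] in auto)
      also have "\<dots> = ?H (insert S (?C \<inter> ?D))" unfolding IH ins ..
      also have "insert S (?C \<inter> ?D) = C \<inter> D" using S T 1 by blast
      finally show ?thesis .
    next
      case 2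
      have "rel_interior S \<inter> T = {}" using simplicial_complex_subset[OF K STK] 2 by blast
      then have "?H C \<inter> ?H D \<subseteq> ?H (C - {S}) \<inter> ?H D"
        using flag_hull_remove_top[OF less.prems(1) S] HT by blast
      also have "\<dots> = ?H ((C - {S}) \<inter> D)"
        by (rule less.hyps) (use cards chain_mono in auto)
      also have "\<dots> \<subseteq> ?H (C \<inter> D)" by (intro hull_mono image_mono) blast
      finally show ?thesis using mono by blast
    next
      case 3
      have "rel_interior T \<inter> S = {}" using simplicial_complex_subset[OF K STK(2,1)] 3 by blast
      then have "?H C \<inter> ?H D \<subseteq> ?H C \<inter> ?H (D - {T})"
        using flag_hull_remove_top[OF less.prems(2) T] HS by blast
      also have "\<dots> = ?H (C \<inter> (D - {T}))"
        by (rule less.hyps) (use cards chain_mono in auto)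
      also have "\<dots> \<subseteq> ?H (C \<inter> D)" by (intro hull_mono image_mono) blast
      finally show ?thesis using mono by blast
    qed
  qed
qed

text \<open>Two simplices give disjoint one-element flags, whose hulls are disjoint by
  \<open>flag_hull_Int\<close>.\<close>

lemma inj_on_barycenter: "inj_on barycenter (K - {{}})"
proof (rule inj_onI)
  fix S T assume ST: "S \<in> K - {{}}" "T \<in> K - {{}}" "barycenter S = barycenter T"
  then have "{S} \<in> chains_of (\<subseteq>) (K - {{}})" "{T} \<in> chains_of (\<subseteq>) (K - {{}})"
    by (auto simp: chains_of_def)
  note Int = flag_hull_Int[OF this]
  show "S = T"
  proof (rule ccontr)
    assume "S \<noteq> T"
    then have "{S} \<inter> {T} = {}" by simp
    then show False using Int ST(3) by (metis Int_absorb convex_hull_singleton image_empty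
          image_insert insert_not_empty convex_hull_empty)
  qed
qed

text \<open>By Radon, dependent points split into two disjoint parts with intersecting hulls. The
  parts come from disjoint subflags, which contradicts \<open>flag_hull_Int\<close>.\<close>

lemma flag_affine_independent:
  assumes C: "C \<in> chains_of (\<subseteq>) (K - {{}})"
  shows "\<not> affine_dependent (barycenter ` C)"
proof
  assume dep: "affine_dependent (barycenter ` C)"
  have sub: "C \<subseteq> K - {{}}" using C by (auto simp: chains_of_def)
  then have "finite (barycenter ` C)"
    using simplicial_complexD(1)[OF K] by (auto intro: finite_subset)
  then obtain M N where MN: "M \<inter> N = {}" "M \<union> N = barycenter ` C" "convex hull M \<inter> convex hull N \<noteq> {}"
    using Radon_partition[OF _ dep] by blast
  then have "M \<subseteq> barycenter ` C" "N \<subseteq> barycenter ` C" by auto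
  then obtain A B where AB: "A \<subseteq> C" "M = barycenter ` A" "B \<subseteq> C" "N = barycenter ` B"
    by (metis subset_imageE)
  then have "A \<in> chains_of (\<subseteq>) (K - {{}})" "B \<in> chains_of (\<subseteq>) (K - {{}})"
    using chains_of_subset[OF C] by auto
  from flag_hull_Int[OF this] MN(1,3) AB show False by auto
qed

lemma flag_vertices:
  assumes "C \<in> chains_of (\<subseteq>) (K - {{}})"
  shows "simplex_vertices (convex hull (barycenter ` C)) = barycenter ` C"
  using flag_affine_independent[OF assms]
  by (simp add: simplex_vertices_def extreme_point_of_convex_hull_affine_independent)

lemma inj_on_flag_hull: "inj_on (\<lambda>C. convex hull (barycenter ` C)) (chains_of (\<subseteq>) (K - {{}}))"
proof (rule inj_onI)
  fix C D assume CD: "C \<in> chains_of (\<subseteq>) (K - {{}})" "D \<in> chains_of (\<subseteq>) (K - {{}})"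
    "convex hull (barycenter ` C) = convex hull (barycenter ` D)"
  then have "barycenter ` C = barycenter ` D" using flag_vertices by metis
  moreover have "C \<subseteq> K - {{}}" "D \<subseteq> K - {{}}" using CD by (auto simp: chains_of_def)
  ultimately show "C = D" using inj_on_image_eq_iff[OF inj_on_barycenter] by blast
qed

text \<open>The geometric realization of the order complex of \<open>Q\<close>, covering both
  barycentric subdivisions and supplements.\<close>

definition flag_complex :: "'a set set \<Rightarrow> 'a set set" where
  "flag_complex Q = (\<lambda>C. convex hull (barycenter ` C)) ` chains_of (\<subseteq>) Q"

context
  fixes Q assumes Q: "Q \<subseteq> K - {{}}"
begin

lemma chains_of_sub: "C \<in> chains_of (\<subseteq>) Q \<Longrightarrow> C \<in> chains_of (\<subseteq>) (K - {{}})"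
  by (rule chains_of_mono[OF _ Q])

lemma simplicial_complex_flag_complex: "simplicial_complex (flag_complex Q)"
  unfolding simplicial_complex_def
proof (intro conjI ballI allI impI)
  have "finite Q" using Q simplicial_complexD(1)[OF K] by (auto intro: finite_subset)
  then show "finite (flag_complex Q)" by (simp add: flag_complex_def finite_chains_of)
next
  fix S assume "S \<in> flag_complex Q"
  then obtain C where C: "C \<in> chains_of (\<subseteq>) Q" "S = convex hull (barycenter ` C)"
    by (auto simp: flag_complex_def)
  show "\<exists>n. n simplex S"
    unfolding C(2) simplex_def using flag_affine_independent[OF chains_of_sub[OF C(1)]]
    by (intro exI[of _ "int (card (barycenter ` C)) - 1"] exI[of _ "barycenter ` C"]) simp
next
  fix F S assume "S \<in> flag_complex Q \<and> F face_of S"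
  then obtain C where C: "C \<in> chains_of (\<subseteq>) Q" "S = convex hull (barycenter ` C)" "F face_of S"
    by (auto simp: flag_complex_def)
  then obtain c where "c \<subseteq> barycenter ` C" "F = convex hull c"
    using face_of_convex_hull_affine_independent[OF flag_affine_independent[OF chains_of_sub[OF C(1)]]] by auto
  then obtain C' where "C' \<subseteq> C" "F = convex hull (barycenter ` C')" by (metis subset_imageE)
  moreover from this have "C' \<in> chains_of (\<subseteq>) Q" using chains_of_subset[OF C(1)] by simp
  ultimately show "F \<in> flag_complex Q" by (auto simp: flag_complex_def)
next
  fix S T assume "S \<in> flag_complex Q \<and> T \<in> flag_complex Q"
  then obtain C D where C: "C \<in> chains_of (\<subseteq>) Q" "S = convex hull (barycenter ` C)"
    and D: "D \<in> chains_of (\<subseteq>) Q" "T = convex hull (barycenter ` D)"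
    by (auto simp: flag_complex_def)
  have eq: "S \<inter> T = convex hull (barycenter ` (C \<inter> D))"
    unfolding C D by (rule flag_hull_Int[OF chains_of_sub[OF C(1)] chains_of_sub[OF D(1)]])
  have "convex hull (barycenter ` (C \<inter> D)) face_of convex hull (barycenter ` C)"
    unfolding face_of_convex_hull_affine_independent[OF flag_affine_independent[OF chains_of_sub[OF C(1)]]]
    by (intro exI[of _ "barycenter ` (C \<inter> D)"]) auto
  then show "(S \<inter> T) face_of S" using eq C(2) by metis
qed

lemma complex_euler_flag_complex: "complex_euler (flag_complex Q) = chain_euler (\<subseteq>) Q"
proof -
  let ?H = "\<lambda>C. convex hull (barycenter ` C)"
  have fin: "finite (chains_of (\<subseteq>) Q)"
    using Q simplicial_complexD(1)[OF K] by (intro finite_chains_of) (auto intro: finite_subset)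
  have "inj_on ?H (chains_of (\<subseteq>) Q)"
    by (rule inj_on_subset[OF inj_on_flag_hull]) (use chains_of_sub in blast)
  then have inj: "inj_on ?H (chains_of (\<subseteq>) Q - {{}})" by (rule inj_on_subset) blast
  have "flag_complex Q - {{}} = ?H ` (chains_of (\<subseteq>) Q - {{}})"
    by (auto simp: flag_complex_def)
  then have "complex_euler (flag_complex Q) = (\<Sum>C\<in>chains_of (\<subseteq>) Q - {{}}. (-1) ^ nat (aff_dim (?H C)))"
    unfolding complex_euler_sum[OF simplicial_complex_flag_complex] by (simp add: sum.reindex[OF inj])
  also have "\<dots> = (\<Sum>C\<in>chains_of (\<subseteq>) Q - {{}}. - ((-1) ^ card C))"
  proof (rule sum.cong)
    fix C assume C: "C \<in> chains_of (\<subseteq>) Q - {{}}"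
    then have "C \<in> chains_of (\<subseteq>) (K - {{}})" using chains_of_sub by blast
    moreover from this have "card (barycenter ` C) = card C"
      by (intro card_image inj_on_subset[OF inj_on_barycenter]) (auto simp: chains_of_def)
    ultimately show "(-1) ^ nat (aff_dim (?H C)) = - ((-1 :: int) ^ card C)"
      using neg_one_aff_dim[OF flag_affine_independent] C by auto
  qed simp
  also have "\<dots> = chain_euler (\<subseteq>) Q"
  proof -
    have "{} \<in> chains_of (\<subseteq>) Q" by (simp add: chains_of_def)
    then show ?thesis using fin by (simp add: chain_euler_def sum_negf sum_diff1)
  qed
  finally show ?thesis .
qed

end

section \<open>Subdivisions and supplements as flag complexes\<close>

lemma barycentric_subdivision_eq: "barycentric_subdivision L = flag_complex (L - {{}})"
  unfolding barycentric_subdivision_def flag_complex_def chains_of_def by blast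

lemma supplement_eq:
  assumes "L \<subseteq> K"
  shows "supplement K L = flag_complex (K - L - {{}})"
proof -
  \<comment> \<open>A vertex of the subdivision of \<open>L\<close> is the barycenter of a simplex
    of \<open>L\<close>; injectivity of barycenters on \<open>K\<close> identifies this simplex with
    \<open>S\<close>.\<close>
  have vertex: "{barycenter S} \<in> barycentric_subdivision L \<longleftrightarrow> S \<in> L" if S: "S \<in> K - {{}}" for S
  proof
    assume "S \<in> L"
    then have "{S} \<in> chains_of (\<subseteq>) (L - {{}})" using S by (simp add: chains_of_def)
    then show "{barycenter S} \<in> barycentric_subdivision L"
      unfolding barycentric_subdivision_eq flag_complex_def by (intro image_eqI[of _ _ "{S}"]) auto
  next
    assume "{barycenter S} \<in> barycentric_subdivision L"
    then obtain C where C: "C \<in> chains_of (\<subseteq>) (L - {{}})" "{barycenter S} = convex hull (barycenter ` C)"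
      unfolding barycentric_subdivision_eq flag_complex_def by auto
    have CL: "C \<subseteq> L - {{}}" using C(1) by (simp add: chains_of_def)
    have "C \<noteq> {}" using C(2) by auto
    then obtain T where T: "T \<in> C" by blast
    then have "barycenter T \<in> convex hull (barycenter ` C)" by (simp add: hull_inc)
    then have "barycenter T = barycenter S" using C(2) by auto
    then have "T = S" using inj_onD[OF inj_on_barycenter, of T S] T CL assms S by blast
    then show "S \<in> L" using T CL by blast
  qed
  have "supplement K L = (\<lambda>C. convex hull (barycenter ` C)) ` {C \<in> chains_of (\<subseteq>) (K - {{}}). \<forall>S\<in>C. S \<notin> L}"
  proof -
    have filter_image: "{S \<in> f ` A. p S} = f ` {x \<in> A. q x}" if "\<And>x. x \<in> A \<Longrightarrow> p (f x) = q x"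
      for f :: "'a set set \<Rightarrow> 'a set" and A p q
      using that by auto
    show ?thesis
      unfolding supplement_def barycentric_subdivision_eq[of K] flag_complex_def
    proof (rule filter_image)
      fix C assume C: "C \<in> chains_of (\<subseteq>) (K - {{}})"
      then have CK: "C \<subseteq> K - {{}}" by (simp add: chains_of_def)
      have "(\<forall>v\<in>barycenter ` C. {v} \<notin> barycentric_subdivision L)
          \<longleftrightarrow> (\<forall>S\<in>C. {barycenter S} \<notin> barycentric_subdivision L)" by simp
      also have "\<dots> \<longleftrightarrow> (\<forall>S\<in>C. S \<notin> L)"
        by (rule ball_cong[OF refl]) (use vertex CK in blast)
      finally show "(\<forall>v\<in>simplex_vertices (convex hull (barycenter ` C)). {v} \<notin> barycentric_subdivision L)
          \<longleftrightarrow> (\<forall>S\<in>C. S \<notin> L)" unfolding flag_vertices[OF C] .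
    qed
  qed
  also have "{C \<in> chains_of (\<subseteq>) (K - {{}}). \<forall>S\<in>C. S \<notin> L} = chains_of (\<subseteq>) (K - L - {{}})"
    unfolding chains_of_def by blast
  finally show ?thesis by (simp add: flag_complex_def)
qed

end

section \<open>Supports of piecewise linear functions\<close>

lemma affine_linear_segment:
  assumes "affine_linear g"
  shows "g ((1 - u) *\<^sub>R x + u *\<^sub>R y) = (1 - u) * g x + u * g y"
proof -
  obtain l c where l: "linear l" and g: "g = (\<lambda>x. l x + c)"
    using assms unfolding affine_linear_def by blast
  interpret linear l by fact
  show ?thesis by (simp add: g add scale left_diff_distrib right_diff_distrib distrib_left)
qed

lemma affine_linear_continuous:
  assumes "affine_linear g"
  shows "continuous_on A g"
proof -
  obtain l c where l: "linear l" and g: "g = (\<lambda>x. l x + c)"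
    using assms unfolding affine_linear_def by blast
  show ?thesis unfolding g by (intro continuous_intros linear_continuous_on_compose[of _ "\<lambda>x. x"] l)
qed

lemma affine_linear_inner: "affine_linear (\<lambda>x. a \<bullet> x - b)"
  unfolding affine_linear_def
  by (intro exI[of _ "\<lambda>x. a \<bullet> x"] exI[of _ "-b"]) (auto intro: linearI simp: inner_add_right)

lemma supp_eq_open_simplices:
  assumes K: "triangulates K P" and lin: "linearizes K f" and f: "f \<in> nabla_pos P"
  shows "supp P f = (\<Union>S\<in>K - zero_subcomplex K f - {{}}. rel_interior S)"
proof (intro equalityI subsetI)
  have cplx: "simplicial_complex K" and P: "\<Union>K = P" using K by (auto simp: triangulates_def)
  fix x assume x: "x \<in> supp P f"
  then have "x \<in> \<Union>K" "f x \<noteq> 0" using P by (auto simp: supp_def)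
  then obtain S where S: "S \<in> K - {{}}" "x \<in> rel_interior S"
    using simplicial_complex_rel_interior[OF cplx] by metis
  then have "x \<in> S" using rel_interior_subset by blast
  then have "S \<notin> zero_subcomplex K f" using \<open>f x \<noteq> 0\<close> by (auto simp: zero_subcomplex_def)
  then show "x \<in> (\<Union>S\<in>K - zero_subcomplex K f - {{}}. rel_interior S)" using S by blast
next
  have cplx: "simplicial_complex K" and P: "\<Union>K = P" using K by (auto simp: triangulates_def)
  have pos: "\<And>x. x \<in> P \<Longrightarrow> 0 \<le> f x" using f by (simp add: nabla_pos_def)
  fix x assume "x \<in> (\<Union>S\<in>K - zero_subcomplex K f - {{}}. rel_interior S)"
  then obtain S where S: "S \<in> K" "S \<notin> zero_subcomplex K f" "x \<in> rel_interior S" by blast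
  then obtain y where y: "y \<in> S" "f y \<noteq> 0" by (auto simp: zero_subcomplex_def)
  have xS: "x \<in> S" using S(3) rel_interior_subset by blast
  have SP: "\<And>z. z \<in> S \<Longrightarrow> z \<in> P" using P S(1) by blast
  obtain g where g: "affine_linear g" "\<And>z. z \<in> S \<Longrightarrow> f z = g z"
    using lin S(1) unfolding linearizes_def by metis
  have "f x \<noteq> 0"
  proof
    assume "f x = 0"
    \<comment> \<open>A nonnegative affine function with a zero in the relative interior vanishes on
      the whole simplex: prolonging the segment from \<open>y\<close> through \<open>x\<close>
      slightly beyond \<open>x\<close> would reach a negative value.\<close>
    obtain e where e: "e > 1" "(1 - e) *\<^sub>R y + e *\<^sub>R x \<in> S"
      using S(3) y(1) xS convex_rel_interior_iff[OF simplicial_complex_closed(1)[OF cplx S(1)]] by (metis empty_iff)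
    have "0 \<le> f ((1 - e) *\<^sub>R y + e *\<^sub>R x)" using pos SP e(2) by blast
    also have "\<dots> = (1 - e) * f y + e * f x"
      using g(2)[OF e(2)] g(2)[OF y(1)] g(2)[OF xS] affine_linear_segment[OF g(1)] by simp
    also have "\<dots> = (1 - e) * f y" using \<open>f x = 0\<close> by simp
    finally have "f y \<le> 0" using e(1) by (simp add: zero_le_mult_iff)
    then show False using pos[OF SP[OF y(1)]] y(2) by simp
  qed
  then show "x \<in> supp P f" using SP[OF xS] by (simp add: supp_def)
qed

lemma alpha_plus_eq:
  assumes "has_euler (top_of_set (supp P f)) {} e"
  shows "alpha_plus P f = real_of_int e"
  unfolding alpha_plus_def by (simp add: homology_euler_eq[OF assms])

text \<open>Both sides equal the order-complex characteristic of the simplices outside the zero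
  complex: on the left these are the cells of the support, on the right the members of the
  flags.\<close>

lemma alpha_plus_supplement:
  assumes K: "triangulates K P" and "linearizes K f" "f \<in> nabla_pos P"
  shows "alpha_plus P f = real_of_int (polyhedron_euler (\<Union>(supplement K (zero_subcomplex K f))))"
proof -
  let ?Z = "zero_subcomplex K f"
  have cplx: "simplicial_complex K" using K by (simp add: triangulates_def)
  have Q: "K - ?Z - {{}} \<subseteq> K - {{}}" by blast
  have "?Z \<subseteq> K" by (auto simp: zero_subcomplex_def)
  then have "polyhedron_euler (\<Union>(supplement K ?Z)) = chain_euler (\<subseteq>) (K - ?Z - {{}})"
    using supplement_eq[OF cplx] polyhedron_euler_eq[OF simplicial_complex_flag_complex[OF cplx Q]]
      complex_euler_flag_complex[OF cplx Q] by simp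
  moreover have "has_euler (top_of_set (supp P f)) {} (chain_euler (\<subseteq>) (K - ?Z - {{}}))"
    unfolding supp_eq_open_simplices[OF assms] by (rule has_euler_open_simplices[OF cplx Q])
  ultimately show ?thesis using alpha_plus_eq by metis
qed

text \<open>The support is starlike around \<open>v\<close>. A simplex containing a point with
  \<open>h x > 0\<close> must have \<open>v\<close> as a vertex, since otherwise \<open>h\<close>
  would vanish at all its vertices and, being affine, everywhere on it.\<close>

lemma alpha_plus_schauder_hat:
  assumes h: "h \<in> nabla_pos P" "schauder_hat P h"
  shows "alpha_plus P h = 1"
proof -
  obtain K v where K: "triangulates K P" "linearizes K h" and v: "{v} \<in> K" "h v = 1"
    and zero: "\<And>w. {w} \<in> K \<Longrightarrow> w \<noteq> v \<Longrightarrow> h w = 0"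
    using h(2) unfolding schauder_hat_def by blast
  have cplx: "simplicial_complex K" and P: "\<Union>K = P" using K by (auto simp: triangulates_def)
  have pos: "\<And>x. x \<in> P \<Longrightarrow> 0 \<le> h x" using h(1) by (simp add: nabla_pos_def)
  have vs: "v \<in> supp P h" using v P by (auto simp: supp_def)
  have "closed_segment v x \<subseteq> supp P h" if x: "x \<in> supp P h" for x
  proof -
    obtain S where S: "S \<in> K" "x \<in> S" using x P by (auto simp: supp_def)
    obtain V where V: "\<not> affine_dependent V" "finite V" "S = convex hull V"
      using simplicial_complex_vertices[OF cplx S(1)] by metis
    obtain g where g: "affine_linear g" "\<And>z. z \<in> S \<Longrightarrow> h z = g z"
      using K(2) S(1) unfolding linearizes_def by metis
    have hx: "h x > 0" using pos x by (force simp: supp_def)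
    have "v \<in> V"
    proof (rule ccontr)
      assume "v \<notin> V"
      have "g w = 0" if w: "w \<in> V" for w
      proof -
        have "w extreme_point_of S"
          using w V by (simp add: extreme_point_of_convex_hull_affine_independent)
        then have "{w} \<in> K" using simplicial_complexD(3)[OF cplx S(1)] by (simp add: face_of_singleton)
        then have "h w = 0" using zero w \<open>v \<notin> V\<close> by metis
        then show ?thesis using g(2) w V(3) hull_inc by metis
      qed
      moreover have "convex {z. g z = 0}"
        by (auto simp: convex_alt affine_linear_segment[OF g(1)])
      ultimately have "S \<subseteq> {z. g z = 0}" unfolding V(3) by (intro hull_minimal) auto
      then show False using hx g(2) S(2) by auto
    qed
    then have "v \<in> S" unfolding V(3) by (rule hull_inc)
    show ?thesis
    proof
      fix z assume "z \<in> closed_segment v x"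
      then obtain u where u: "0 \<le> u" "u \<le> 1" "z = (1 - u) *\<^sub>R v + u *\<^sub>R x"
        by (auto simp: in_segment)
      have zS: "z \<in> S"
        using \<open>z \<in> closed_segment v x\<close> closed_segment_subset[OF \<open>v \<in> S\<close> S(2)]
          simplicial_complex_closed(1)[OF cplx S(1)] by blast
      have "h z = (1 - u) * h v + u * h x"
        using g(2)[OF zS] g(2)[OF \<open>v \<in> S\<close>] g(2)[OF S(2)] affine_linear_segment[OF g(1)] u(3) by simp
      also have "\<dots> > 0"
      proof (cases "u = 0")
        case False
        then have "u * h x > 0" "(1 - u) * h v \<ge> 0" using u hx v(2) by auto
        then show ?thesis by linarith
      qed (use v(2) in simp)
      finally show "z \<in> supp P h" using zS S(1) P by (auto simp: supp_def)
    qed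
  qed
  then have "starlike (supp P h)" unfolding starlike_def using vs by blast
  then have "has_euler (top_of_set (supp P h)) {} 1"
    using vs by (intro has_euler_contractible) (auto simp: starlike_imp_contractible)
  then show ?thesis using alpha_plus_eq[of P h 1] by simp
qed

text \<open>The cells of the hyperplane arrangement given by \<open>H\<close> are indexed by sign vectors.\<close>

lemma has_euler_sign_saturated:
  fixes X :: "'a::euclidean_space set"
  assumes H: "finite H" "\<And>h. h \<in> H \<Longrightarrow> affine_linear h"
    and sat: "\<And>x y. x \<in> X \<Longrightarrow> (\<And>h. h \<in> H \<Longrightarrow> sgn (h x) = sgn (h y)) \<Longrightarrow> y \<in> X"
  shows "\<exists>e. has_euler (top_of_set X) {} e"
proof -
  define sv where "sv = (\<lambda>x. restrict (\<lambda>h. sgn (h x)) H)"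
  define cell where "cell = (\<lambda>s. {x::'a. sv x = s})"
  \<comment> \<open>\<open>s\<close> arises from \<open>t\<close> by replacing some signs with 0, as
    happens when a point moves to the boundary of a cell.\<close>
  define below where "below = (\<lambda>s t. \<forall>h\<in>H. s h = 0 \<or> s h = (t h :: real))"
  have sv: "sv x h = sgn (h x)" if "h \<in> H" for x h using that by (simp add: sv_def)
  have sv_eqI: "sv x = sv y" if "\<And>h. h \<in> H \<Longrightarrow> sgn (h x) = sgn (h y)" for x y
    unfolding sv_def using that by (intro restrict_ext) auto
  have "sgn r \<in> {-1, 0, 1}" for r :: real by (simp add: sgn_real_def)
  then have "sv ` X \<subseteq> H \<rightarrow>\<^sub>E {-1, 0, 1}" unfolding sv_def by (simp only: image_subset_iff restrict_PiE_iff) blast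
  then have fin: "finite (sv ` X)" using H(1) by (rule finite_subset[OF _ finite_PiE]) auto
  have "cell_poset below cell (sv ` X)"
    unfolding cell_poset_def
  proof (intro conjI ballI impI)
    show "finite (sv ` X)" by (rule fin)
  next
    fix s assume "s \<in> sv ` X"
    then show "cell s \<noteq> {}" "below s s" by (auto simp: cell_def below_def)
  next
    fix s t :: "('a \<Rightarrow> real) \<Rightarrow> real" assume "s \<noteq> t"
    then show "cell s \<inter> cell t = {}" by (auto simp: cell_def)
  next
    fix s t r assume "below s t" "below t r"
    then show "below s r" unfolding below_def by metis
  next
    fix s t assume st: "s \<in> sv ` X" "t \<in> sv ` X" "cell s \<inter> closure (cell t) \<noteq> {}"
    then obtain c where c: "sv c = s" "c \<in> closure (cell t)" by (auto simp: cell_def)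
    obtain x where x: "t = sv x" using st(2) by blast
    show "below s t"
      unfolding below_def
    proof
      fix h assume h: "h \<in> H"
      \<comment> \<open>The weak form of the sign condition at \<open>h\<close>. It is a closed
        condition, so it survives at the limit point \<open>c\<close>.\<close>
      let ?A = "{y. 0 \<le> t h * h y \<and> (t h = 0 \<longrightarrow> h y = 0)}"
      have cont: "continuous_on UNIV h" by (rule affine_linear_continuous[OF H(2)[OF h]])
      have "closed {y. 0 \<le> t h * h y}" "closed {y. h y = 0}"
        by (intro closed_Collect_le closed_Collect_eq continuous_intros cont)+
      then have "closed ?A"
        by (cases "t h = 0") simp_all
      moreover have "cell t \<subseteq> ?A"
        using sv[OF h] by (auto simp: cell_def sgn_real_def split: if_splits)
      ultimately have "c \<in> ?A" using c(2) closure_minimal by blast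
      moreover have "t h = sgn (h x)" "s h = sgn (h c)" using sv[OF h] x c(1) by auto
      ultimately show "s h = 0 \<or> s h = t h"
        by (auto simp: sgn_real_def split: if_splits)
    qed
  next
    fix s t c x assume st: "below s t" and c: "c \<in> cell s" and x: "x \<in> cell t"
    show "open_segment c x \<subseteq> cell t"
    proof
      fix z assume "z \<in> open_segment c x"
      then obtain u where u: "0 < u" "u < 1" "z = (1 - u) *\<^sub>R c + u *\<^sub>R x"
        by (auto simp: in_segment)
      have "sv z = sv x"
      proof (rule sv_eqI)
        fix h assume h: "h \<in> H"
        have hz: "h z = (1 - u) * h c + u * h x"
          unfolding u(3) by (rule affine_linear_segment[OF H(2)[OF h]])
        have "sgn (h c) = 0 \<or> sgn (h c) = sgn (h x)"
          using st c x sv[OF h] h by (auto simp: below_def cell_def)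
        then consider "h c = 0" | "h c > 0" "h x > 0" | "h c < 0" "h x < 0"
          by (auto simp: sgn_real_def split: if_splits)
        then show "sgn (h z) = sgn (h x)"
        proof cases
          case 1
          then show ?thesis unfolding hz using u(1) by (simp add: sgn_mult)
        next
          case 2
          then have "h z > 0" unfolding hz using u by (intro add_pos_pos mult_pos_pos) auto
          then show ?thesis using 2 by simp
        next
          case 3
          then have "h z < 0" unfolding hz using u by (intro add_neg_neg mult_pos_neg) auto
          then show ?thesis using 3 by simp
        qed
      qed
      then show "z \<in> cell t" using x by (simp add: cell_def)
    qed
  qed
  from has_euler_cells[OF this] have "has_euler (top_of_set (\<Union>s\<in>sv ` X. cell s)) {} (chain_euler below (sv ` X))" .
  moreover have "(\<Union>s\<in>sv ` X. cell s) = X"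
  proof (intro equalityI subsetI)
    fix y assume "y \<in> (\<Union>s\<in>sv ` X. cell s)"
    then obtain x where x: "x \<in> X" "sv y = sv x" by (auto simp: cell_def)
    show "y \<in> X" by (rule sat[OF x(1)]) (metis sv x(2))
  qed (auto simp: cell_def)
  ultimately show ?thesis by metis
qed

section \<open>Supports are unions of sign cells\<close>

lemma polyhedron_sign_determined:
  fixes S :: "'a::euclidean_space set"
  assumes "polyhedron S"
  shows "\<exists>H. finite H \<and> (\<forall>h\<in>H. affine_linear h) \<and>
     (\<forall>x y. x \<in> S \<longrightarrow> (\<forall>h\<in>H. sgn (h x) = sgn (h y)) \<longrightarrow> y \<in> S)"
proof -
  obtain F where F: "finite F" "S = \<Inter>F" "\<forall>h\<in>F. \<exists>a b. a \<noteq> 0 \<and> h = {x. a \<bullet> x \<le> b}"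
    using assms unfolding polyhedron_def by blast
  then obtain a b where ab: "\<And>h. h \<in> F \<Longrightarrow> h = {x. a h \<bullet> x \<le> b h}" by metis
  let ?H = "(\<lambda>h x. a h \<bullet> x - b h) ` F"
  have "y \<in> S" if x: "x \<in> S" and eq: "\<forall>h\<in>?H. sgn (h x) = sgn (h y)" for x y
    unfolding F(2)
  proof
    fix h assume h: "h \<in> F"
    then have "a h \<bullet> x \<le> b h" using x F(2) ab by blast
    moreover have "sgn (a h \<bullet> x - b h) = sgn (a h \<bullet> y - b h)" using eq h by simp
    ultimately have "a h \<bullet> y \<le> b h" by (auto simp: sgn_real_def split: if_splits)
    then show "y \<in> h" using ab[OF h] by blast
  qed
  then show ?thesis using F(1) affine_linear_inner by (intro exI[of _ ?H]) auto
qed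

lemma sgn_affine_linear_segment:
  assumes "affine_linear h" "sgn (h x) = sgn (h y)" "z \<in> closed_segment x y"
  shows "sgn (h z) = sgn (h x)"
proof -
  obtain u where u: "0 \<le> u" "u \<le> 1" "z = (1 - u) *\<^sub>R x + u *\<^sub>R y"
    using assms(3) by (auto simp: in_segment)
  have hz: "h z = (1 - u) * h x + u * h y"
    unfolding u(3) by (rule affine_linear_segment[OF assms(1)])
  consider "h x = 0" "h y = 0" | "h x > 0" "h y > 0" | "h x < 0" "h y < 0"
    using assms(2) by (auto simp: sgn_real_def split: if_splits)
  then show ?thesis
  proof cases
    case 2
    then have "- h z < 0"
      unfolding hz using convex_bound_lt[of "- h x" 0 "- h y" "1 - u" u] u by simp
    then show ?thesis using 2 by simp
  next
    case 3
    then have "h z < 0" unfolding hz using u by (intro convex_bound_lt) auto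
    then show ?thesis using 3 by simp
  next
    case 1
    then show ?thesis unfolding hz by simp
  qed
qed

text \<open>Points \<open>x\<close>, \<open>y\<close> with equal signs may lie where
  \<open>f\<close> follows different affine pieces, so nonvanishing is carried from \<open>x\<close>
  to \<open>y\<close> along their segment. The functions \<open>HS\<close> keep the segment in
  \<open>P\<close>, the functions \<open>A\<close> keep their signs on it, and \<open>f\<close>
  cannot pass to 0 because the segment is connected.\<close>

lemma has_euler_supp:
  assumes P: "pl_polyhedron P" and f: "f \<in> nabla P"
  shows "\<exists>e. has_euler (top_of_set (supp P f)) {} e"
proof -
  obtain K where K: "simplicial_complex K" "\<Union>K = P"
    using P unfolding pl_polyhedron_def triangulates_def by blast
  have "\<forall>S\<in>K. \<exists>H. finite H \<and> (\<forall>h\<in>H. affine_linear h) \<and>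
     (\<forall>x y. x \<in> S \<longrightarrow> (\<forall>h\<in>H. sgn (h x) = sgn (h y)) \<longrightarrow> y \<in> S)"
    using simplicial_complex_closed(3)[OF K(1)] polytope_imp_polyhedron polyhedron_sign_determined by blast
  then obtain HS where HS: "\<And>S. S \<in> K \<Longrightarrow> finite (HS S)" "\<And>S h. S \<in> K \<Longrightarrow> h \<in> HS S \<Longrightarrow> affine_linear h"
    "\<And>S x y. S \<in> K \<Longrightarrow> x \<in> S \<Longrightarrow> (\<And>h. h \<in> HS S \<Longrightarrow> sgn (h x) = sgn (h y)) \<Longrightarrow> y \<in> S"
    by metis
  obtain A where A: "finite A" "\<And>g. g \<in> A \<Longrightarrow> affine_linear g" "\<And>s. s \<in> P \<Longrightarrow> \<exists>g\<in>A. f s = g s"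
    and cont: "continuous_on P f"
    using f unfolding nabla_def by blast
  define H where "H = A \<union> (\<Union>S\<in>K. HS S)"
  have aff: "affine_linear h" if "h \<in> H" for h using that A(2) HS(2) by (auto simp: H_def)
  show ?thesis
  proof (rule has_euler_sign_saturated)
    show "finite H" using A(1) HS(1) simplicial_complexD(1)[OF K(1)] by (auto simp: H_def)
    show "affine_linear h" if "h \<in> H" for h by (rule aff[OF that])
    fix x y assume x: "x \<in> supp P f" and eq: "\<And>h. h \<in> H \<Longrightarrow> sgn (h x) = sgn (h y)"
    let ?seg = "closed_segment x y"
    obtain S where S: "S \<in> K" "x \<in> S" using x K(2) by (auto simp: supp_def)
    have seg_sgn: "sgn (h z) = sgn (h x)" if "h \<in> H" "z \<in> ?seg" for h z
      by (rule sgn_affine_linear_segment[OF aff[OF that(1)] eq[OF that(1)] that(2)])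
    have segP: "z \<in> P" if "z \<in> ?seg" for z
    proof -
      have "sgn (h x) = sgn (h z)" if "h \<in> HS S" for h
      proof -
        have "h \<in> H" using that S(1) by (auto simp: H_def)
        from seg_sgn[OF this \<open>z \<in> ?seg\<close>] show ?thesis by (rule sym)
      qed
      then have "z \<in> S" by (rule HS(3)[OF S])
      then show ?thesis using S(1) K(2) by blast
    qed
    have cont_seg: "continuous_on ?seg f"
      by (rule continuous_on_subset[OF cont]) (use segP in blast)
    define E0 where "E0 = {s \<in> ?seg. f s = 0}"
    \<comment> \<open>Points where \<open>f\<close> agrees with a piece that is nonzero at
      \<open>x\<close>. Such a piece is nonzero along the whole segment, so \<open>E0\<close> and
      \<open>E1\<close> are disjoint closed sets covering the segment.\<close>
    define E1 where "E1 = (\<Union>g\<in>{g \<in> A. g x \<noteq> 0}. {s \<in> ?seg. f s - g s = 0})"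
    have c0: "closed E0" unfolding E0_def
      by (rule continuous_closed_preimage_constant[OF cont_seg closed_segment])
    have c1: "closed E1" unfolding E1_def
      by (intro closed_UN ballI continuous_closed_preimage_constant continuous_on_diff cont_seg
          affine_linear_continuous closed_segment) (use A in auto)
    have cover: "?seg \<subseteq> E0 \<union> E1"
    proof
      fix s assume s: "s \<in> ?seg"
      then obtain g where g: "g \<in> A" "f s = g s" using A(3) segP by blast
      show "s \<in> E0 \<union> E1"
      proof (cases "g x = 0")
        case True
        then have "g s = 0" using seg_sgn[of g s] g(1) s by (simp add: H_def sgn_zero_iff)
        then show ?thesis using s g by (simp add: E0_def)
      qed (use s g in \<open>auto simp: E1_def\<close>)
    qed
    have disj: "E0 \<inter> E1 \<inter> ?seg = {}"
    proof (rule equals0I)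
      fix s assume "s \<in> E0 \<inter> E1 \<inter> ?seg"
      then obtain g where g: "g \<in> A" "g x \<noteq> 0" "g s = 0" "s \<in> ?seg"
        by (auto simp: E0_def E1_def)
      then show False using seg_sgn[of g s] by (simp add: H_def sgn_zero_iff)
    qed
    have ne: "E1 \<inter> ?seg \<noteq> {}"
    proof -
      have "x \<in> P" "f x \<noteq> 0" using x by (auto simp: supp_def)
      then obtain g where "g \<in> A" "f x = g x" using A(3) by blast
      then have "x \<in> E1" using \<open>f x \<noteq> 0\<close> by (auto simp: E1_def)
      then show ?thesis by auto
    qed
    have "E0 \<inter> ?seg = {}"
      using connected_closedD[OF connected_segment(1) disj cover c0 c1] ne by blast
    then have "f y \<noteq> 0" by (auto simp: E0_def)
    then show "y \<in> supp P f" using segP[of y] by (simp add: supp_def)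
  qed
qed

section \<open>Lattice operations and additivity\<close>

lemma nabla_min:
  assumes "f \<in> nabla P" "g \<in> nabla P"
  shows "(\<lambda>x. min (f x) (g x)) \<in> nabla P"
proof -
  obtain A where A: "finite A" "\<forall>h\<in>A. affine_linear h" "\<forall>s\<in>P. \<exists>h\<in>A. f s = h s" "continuous_on P f"
    using assms(1) unfolding nabla_def by blast
  obtain B where B: "finite B" "\<forall>h\<in>B. affine_linear h" "\<forall>s\<in>P. \<exists>h\<in>B. g s = h s" "continuous_on P g"
    using assms(2) unfolding nabla_def by blast
  have "\<exists>h\<in>A \<union> B. min (f s) (g s) = h s" if "s \<in> P" for s
    using A(3) B(3) that by (cases "f s \<le> g s") (auto simp: min_def)
  then show ?thesis
    unfolding nabla_def using A B by (auto intro!: continuous_on_min exI[of _ "A \<union> B"])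
qed

lemma openin_supp:
  assumes "f \<in> nabla P"
  shows "openin (top_of_set P) (supp P f)"
proof -
  have "continuous_on P f" using assms by (simp add: nabla_def)
  then have "openin (top_of_set P) (P \<inter> f -` (- {0}))"
    by (rule continuous_openin_preimage_gen) (simp add: open_Compl)
  moreover have "P \<inter> f -` (- {0}) = supp P f" by (auto simp: supp_def)
  ultimately show ?thesis by simp
qed

text \<open>Nonnegativity turns maximum and minimum into union and intersection of supports; for
  mixed signs the maximum could vanish where one function does not. Finite rank for the union comes
  out of \<open>has_euler_Un\<close>.\<close>

lemma alpha_plus_max:
  assumes P: "pl_polyhedron P" and f: "f \<in> nabla_pos P" and g: "g \<in> nabla_pos P"
  shows "alpha_plus P (\<lambda>x. max (f x) (g x)) =
     alpha_plus P f + alpha_plus P g - alpha_plus P (\<lambda>x. min (f x) (g x))"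
proof -
  have nab: "f \<in> nabla P" "g \<in> nabla P" using f g by (auto simp: nabla_pos_def)
  have pos: "\<And>x. x \<in> P \<Longrightarrow> 0 \<le> f x" "\<And>x. x \<in> P \<Longrightarrow> 0 \<le> g x"
    using f g by (auto simp: nabla_pos_def)
  let ?F = "supp P f" and ?G = "supp P g"
  have max: "supp P (\<lambda>x. max (f x) (g x)) = ?F \<union> ?G"
    using pos by (force simp: supp_def max_def)
  have min: "supp P (\<lambda>x. min (f x) (g x)) = ?F \<inter> ?G"
    using pos by (force simp: supp_def min_def)
  obtain a where a: "has_euler (top_of_set ?F) {} a" using has_euler_supp[OF P nab(1)] by blast
  obtain b where b: "has_euler (top_of_set ?G) {} b" using has_euler_supp[OF P nab(2)] by blast
  obtain c where c: "has_euler (top_of_set (?F \<inter> ?G)) {} c"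
    using has_euler_supp[OF P nabla_min[OF nab]] min by auto
  have sub: "?F \<union> ?G \<subseteq> P" by (auto simp: supp_def)
  have Int: "(?F \<union> ?G) \<inter> (?F \<inter> ?G) = ?F \<inter> ?G" by blast
  have "openin (top_of_set (?F \<union> ?G)) ?F" "openin (top_of_set (?F \<union> ?G)) ?G"
    using openin_supp[OF nab(1)] openin_supp[OF nab(2)] sub by (auto intro: openin_subset_trans)
  then have "has_euler (top_of_set (?F \<union> ?G)) {} (a + b - c)"
    by (rule has_euler_Un) (use a b c Int in \<open>auto simp: subtopology_subtopology Int_absorb1\<close>)
  then have "alpha_plus P (\<lambda>x. max (f x) (g x)) = real_of_int (a + b - c)"
    by (intro alpha_plus_eq) (simp add: max)
  moreover have "alpha_plus P (\<lambda>x. min (f x) (g x)) = real_of_int c"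
    by (intro alpha_plus_eq) (simp add: min c)
  ultimately show ?thesis using alpha_plus_eq[OF a] alpha_plus_eq[OF b] by simp
qed

theorem lemma3p1:
  fixes P :: "'a::euclidean_space set"
  assumes "pl_polyhedron P"
  shows "(\<forall>f \<in> nabla_pos P. \<forall>K. triangulates K P \<and> linearizes K f \<longrightarrow>
            alpha_plus P f =
              real_of_int (polyhedron_euler (\<Union>(supplement K (zero_subcomplex K f))))) \<and>
         alpha_plus P (\<lambda>x. 0) = 0 \<and>
         (\<forall>h \<in> nabla_pos P. schauder_hat P h \<longrightarrow> alpha_plus P h = 1) \<and>
         (\<forall>f \<in> nabla_pos P. \<forall>g \<in> nabla_pos P.
            alpha_plus P (\<lambda>x. f x + g x) = alpha_plus P (\<lambda>x. max (f x) (g x)) \<and>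
            alpha_plus P (\<lambda>x. max (f x) (g x)) =
              alpha_plus P f + alpha_plus P g - alpha_plus P (\<lambda>x. min (f x) (g x)))"
proof (intro conjI ballI allI impI)
  fix f K assume "f \<in> nabla_pos P" "triangulates K P \<and> linearizes K f"
  then show "alpha_plus P f = real_of_int (polyhedron_euler (\<Union>(supplement K (zero_subcomplex K f))))"
    by (intro alpha_plus_supplement) auto
next
  have "has_euler (top_of_set (supp P (\<lambda>x. 0))) {} 0"
    by (rule has_euler_empty) (simp add: supp_def)
  then show "alpha_plus P (\<lambda>x. 0) = 0" using alpha_plus_eq[of P "\<lambda>x. 0" 0] by simp
next
  fix h assume "h \<in> nabla_pos P" "schauder_hat P h"
  then show "alpha_plus P h = 1" by (rule alpha_plus_schauder_hat)
next
  fix f g assume fg: "f \<in> nabla_pos P" "g \<in> nabla_pos P"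
  \<comment> \<open>A sum of nonnegative numbers vanishes exactly when both do, just like their
    maximum, and \<open>alpha_plus\<close> depends only on the support.\<close>
  then have "supp P (\<lambda>x. f x + g x) = supp P (\<lambda>x. max (f x) (g x))"
    by (force simp: supp_def max_def nabla_pos_def)
  then show "alpha_plus P (\<lambda>x. f x + g x) = alpha_plus P (\<lambda>x. max (f x) (g x))"
    by (simp add: alpha_plus_def)
  show "alpha_plus P (\<lambda>x. max (f x) (g x)) =
      alpha_plus P f + alpha_plus P g - alpha_plus P (\<lambda>x. min (f x) (g x))"
    by (rule alpha_plus_max[OF assms fg])
qed

end
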